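(* The following estimates hold. 1. For any $\delta>0$ there exists a constant $C_\delta>0$ such that for any $v^{(1)},\dots,v^{(6)}\in\mathcal V^{\frac56+\delta}_{t,x}$, $$\Big|\int_{\mathbb T}\int_0^\pi v^{(1)}(t,x)\cdots v^{(6)}(t,x)\,\sin^2(x)\,\tfrac2\pi dx\,\tfrac1\pi dt\Big|\le C_\delta\prod_{n=1}^6\|v^{(n)}\|_{\mathcal V^{\frac56+\delta}_{t,x}}.$$ 2. For any $\delta>0$ there exists a constant $C_\delta>0$ such that for any $v^{(1)},\dots,v^{(5)}\in\mathcal V^{1+\delta}_{t,x}$ and $v^{(6)}\in\mathcal V^1_{t,x}$, $$\Big|\int_{\mathbb T}\int_0^\pi v^{(1)}(t,x)\cdots v^{(6)}(t,x)\,\sin^2(x)\,\tfrac2\pi dx\,\tfrac1\pi dt\Big|\le C_\delta\Big(\prod_{n=1}^5\|v^{(n)}\|_{\mathcal V^{1+\delta}_{t,x}}\Big)\|v^{(6)}\|_{\mathcal V^{-\delta}_{t,x}}.$$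
   Context: $\mathbb T=\mathbb R/2\pi\mathbb Z$, $\mathbb N=\{0,1,2,\dots\}$. For $j\in\mathbb N$ put $e_j(x)=\frac{\sin((j+1)x)}{\sin x}$, $x\in(0,\pi)$, and $\omega_j=j+1$; $\{e_j\}$ is an orthonormal basis of $L^2((0,\pi),\sin^2(x)\frac2\pi dx)$. For $s\in\mathbb R$, $\mathcal V^s_{t,x}$ is the space of real functions (distributions) $v(t,x)=\sum_{j\in\mathbb N}v_j\cos(\omega_jt)e_j(x)$, $v_j\in\mathbb R$, with norm $\|v\|^2_{\mathcal V^s_{t,x}}=\sum_{j\in\mathbb N}|v_j|^2\omega_j^{2s}<\infty$. (These are the even-in-time, spherically symmetric solutions of $-\partial_{tt}v+\Delta_{\mathbb S^3}v-v=0$.) *)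

theory Defs
  imports "HOL-Analysis.Analysis"
begin

definition freq :: "nat \<Rightarrow> real" where
  "freq j = real j + 1"

definition eigf :: "nat \<Rightarrow> real \<Rightarrow> real" where
  "eigf j x = sin (freq j * x) / sin x"

text \<open>
  An element of \<open>\<V>\<^sup>s\<close>, in general only a distribution, is represented by its real coefficient
  sequence \<open>v\<close>, so that all orders \<open>s\<close>, including negative ones, are treated uniformly.
\<close>

definition V_space :: "real \<Rightarrow> (nat \<Rightarrow> real) set" where
  "V_space s = {v. summable (\<lambda>j. \<bar>v j\<bar>\<^sup>2 * freq j powr (2 * s))}"

definition V_norm :: "real \<Rightarrow> (nat \<Rightarrow> real) \<Rightarrow> real" where
  "V_norm s v = sqrt (\<Sum>j. \<bar>v j\<bar>\<^sup>2 * freq j powr (2 * s))"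

text \<open>
  The function \<open>v(t,x)\<close> with coefficients \<open>v\<close>. The pointwise sum is meaningful when \<open>s > 1/2\<close>: the
  series then converges absolutely for all \<open>t\<close> and all \<open>x\<close> in \<open>(0,\<pi>)\<close>, as shown in
  \<open>V_fun_abs_summable\<close> below.
\<close>

definition V_fun :: "(nat \<Rightarrow> real) \<Rightarrow> real \<Rightarrow> real \<Rightarrow> real" where
  "V_fun v t x = (\<Sum>j. v j * cos (freq j * t) * eigf j x)"

text \<open>
  The torus is represented by the fundamental domain \<open>[0,2\<pi>]\<close>. Since the Bochner integral of a
  non-integrable function is \<open>0\<close> by convention, absolute integrability is a separate predicate.
\<close>

definition spacetime_integrable :: "(real \<Rightarrow> real \<Rightarrow> real) \<Rightarrow> bool" where
  "spacetime_integrable f \<longleftrightarrow>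
     set_integrable lborel ({0..2 * pi} \<times> {0<..<pi})
       (\<lambda>(t, x). f t x * (sin x)\<^sup>2 * (2 / pi) * (1 / pi))"

definition spacetime_integral :: "(real \<Rightarrow> real \<Rightarrow> real) \<Rightarrow> real" where
  "spacetime_integral f =
     (LBINT t:{0..2 * pi}. (LBINT x:{0<..<pi}. f t x * (sin x)\<^sup>2 * (2 / pi)) * (1 / pi))"

lemma V_fun_abs_summable:
  assumes v: "v \<in> V_space s" and s: "s > 1 / 2" and x: "0 < x" "x < pi"
  shows "summable (\<lambda>j. \<bar>v j * cos (freq j * t) * eigf j x\<bar>)"
proof -
  have sin_pos: "sin x > 0"
    using x by (rule sin_gt_zero)
  have "summable (\<lambda>j. real (Suc j) powr (- 2 * s))"
    unfolding summable_Suc_iff[of "\<lambda>j. real j powr (- 2 * s)"]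
    using s by (subst summable_real_powr_iff) auto
  then have 1: "summable (\<lambda>j. freq j powr (- 2 * s))"
    by (simp add: freq_def add.commute)
  have 2: "summable (\<lambda>j. \<bar>v j\<bar>\<^sup>2 * freq j powr (2 * s))"
    using v by (simp add: V_space_def)
  have bound: "\<bar>v j * cos (freq j * t) * eigf j x\<bar>
      \<le> (\<bar>v j\<bar>\<^sup>2 * freq j powr (2 * s) + freq j powr (- 2 * s)) / sin x" for j
  proof -
    have pos: "freq j > 0"
      by (simp add: freq_def)
    have pow2: "(freq j powr r)\<^sup>2 = freq j powr (2 * r)" for r
      by (simp add: power2_eq_square flip: powr_add)
    define a b where "a = \<bar>v j\<bar> * freq j powr s" and "b = freq j powr (- s)"
    have ab: "a * b = \<bar>v j\<bar>"
      using pos by (simp add: a_def b_def powr_minus)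
    have a2: "a\<^sup>2 = \<bar>v j\<bar>\<^sup>2 * freq j powr (2 * s)"
      by (simp add: a_def power_mult_distrib pow2)
    have b2: "b\<^sup>2 = freq j powr (- 2 * s)"
      using pow2[of "- s"] by (simp add: b_def)
    have "a * b \<ge> 0"
      by (simp add: ab)
    then have "\<bar>v j\<bar> \<le> a\<^sup>2 + b\<^sup>2"
      using sum_squares_bound[of a b] ab by linarith
    moreover have "\<bar>v j * cos (freq j * t) * sin (freq j * x)\<bar> \<le> \<bar>v j\<bar>"
      by (simp add: abs_mult mult.assoc mult_le_one mult_left_le)
    ultimately have "\<bar>v j * cos (freq j * t) * sin (freq j * x)\<bar> / sin x \<le> (a\<^sup>2 + b\<^sup>2) / sin x"
      using sin_pos by (intro divide_right_mono) auto
    then show ?thesis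
      using sin_pos by (simp add: eigf_def a2 b2 abs_mult)
  qed
  show ?thesis
    by (rule summable_comparison_test'[OF summable_divide[OF summable_add[OF 2 1], of "sin x"], where N = 0])
      (use bound in auto)
qed

end

theory Submission
  imports Defs
begin

text \<open>
  From \<open>|e\<^sub>j(x)| \<le> min \<omega>\<^sub>j (1 / sin x)\<close> one gets \<open>|e\<^sub>j(x)| \<le> \<omega>\<^sub>j\<^sup>\<theta> (sin x)\<^sup>\<theta>\<^sup>-\<^sup>1\<close> for \<open>0 \<le> \<theta> \<le> 1\<close>. Hence, at a
  fixed \<open>x\<close>, a function in \<open>\<V>\<^sup>s\<close> is bounded in \<open>t\<close> by \<open>(sin x)\<^sup>\<theta>\<^sup>-\<^sup>1\<close> for every \<open>\<theta> < s - 1/2\<close> (Cauchy-Schwarz),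
  while a function in \<open>\<V>\<^sup>\<sigma>\<close> has \<open>L\<^sup>2\<close> norm in \<open>t\<close> at most a constant times \<open>(sin x)\<^sup>\<sigma>\<^sup>-\<^sup>1\<close> (Parseval). Putting
  four factors in \<open>L\<^sup>\<infinity>\<close> and two in \<open>L\<^sup>2\<close> in time leaves a power of \<open>sin x\<close> which, together with the weight
  \<open>sin\<^sup>2 x\<close>, is integrable: for the first estimate \<open>\<theta> > 1/3\<close> and \<open>\<sigma> = 5/6\<close> for both \<open>L\<^sup>2\<close> factors.

  For the second estimate, the integrals of \<open>\<Prod> cos (\<omega>\<^sub>j t)\<close> over \<open>t\<close> and of \<open>\<Prod> e\<^sub>j(x) sin\<^sup>2 x\<close> over \<open>x\<close> are all
  nonnegative, and the former vanishes unless the sixth frequency is at most the sum of the other five. So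
  the coefficients may be replaced by their absolute values, and the weight \<open>\<omega>\<^sub>6\<^sup>\<delta>\<close> may be transferred
  to one of the first five factors. The resulting integrals obey the same bound, with that factor
  in \<open>\<V>\<^sup>1\<close> and the sixth in \<open>\<V>\<^sup>0\<close> placed in \<open>L\<^sup>2\<close> and with \<open>\<theta> > 1/2\<close> for the others.
\<close>

section \<open>Integrability of powers of the sine\<close>

text \<open>Jordan's inequality: the sine is concave on [0, pi], so on the first half it lies above
  the chord from (0, 0) to (pi / 2, 1).\<close>

lemma sin_ge_linear:
  assumes "0 \<le> x" "x \<le> pi / 2"
  shows "2 / pi * x \<le> sin x"
proof -
  have "convex_on {0..pi} (\<lambda>x::real. - sin x)"
    by (rule f''_ge0_imp_convex[where f' = "\<lambda>x. - cos x" and f'' = sin])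
      (auto intro!: derivative_eq_intros sin_ge_zero)
  from convex_onD[OF this, of "2 / pi * x" 0 "pi / 2"] show ?thesis
    using assms by (simp add: field_simps)
qed

text \<open>For p >= 0 the integrand is at most 1. For -1 < p < 0 Jordan's inequality compares the
  singularities at the two endpoints with those of x^p and (pi - x)^p.\<close>

lemma set_integrable_sin_powr:
  assumes p: "p > -1"
  shows "set_integrable lborel {0<..<pi} (\<lambda>x. sin x powr p)"
proof (cases "p \<ge> 0")
  case True
  have "set_integrable lborel {0<..<pi} (\<lambda>x. 1 :: real)"
    by (simp add: set_integrable_def)
  then show ?thesis
  proof (rule set_integrable_bound)
    show "set_borel_measurable lborel {0<..<pi} (\<lambda>x. sin x powr p)"
      by (simp add: set_borel_measurable_def)
    show "AE x in lborel. x \<in> {0<..<pi} \<longrightarrow> norm (sin x powr p) \<le> norm (1::real)"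
      using True by (auto intro!: powr_le1 sin_ge_zero)
  qed
next
  case False
  have "(\<lambda>x::real. x powr p) absolutely_integrable_on {0..pi}"
    using p by (intro nonnegative_absolutely_integrable_1 integrable_on_powr_from_0) auto
  then have "set_integrable lborel {0..pi} (\<lambda>x. x powr p)"
    by (simp add: set_integrable_def integrable_completion)
  then have left: "set_integrable lborel {0<..<pi} (\<lambda>x. x powr p)"
    by (rule set_integrable_subset) auto
  \<comment> \<open>The reflection x -> pi - x preserves the interval and moves the singularity to
    the other endpoint.\<close>
  have "set_integrable lborel {0<..<pi} (\<lambda>x. (pi - x) powr p)"
  proof -
    have "(\<lambda>x. indicator {0<..<pi} (pi + - 1 * x) *\<^sub>R (pi + - 1 * x) powr p) =
        (\<lambda>x. indicator {0<..<pi} x *\<^sub>R (pi - x) powr p)"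
      by (auto simp: indicator_def)
    then show ?thesis
      using lborel_integrable_real_affine[OF left[unfolded set_integrable_def], of "- 1" pi]
      unfolding set_integrable_def by simp
  qed
  with left have "set_integrable lborel {0<..<pi} (\<lambda>x. x powr p + (pi - x) powr p)"
    by (rule set_integral_add)
  then have "set_integrable lborel {0<..<pi} (\<lambda>x. (2 / pi) powr p * (x powr p + (pi - x) powr p))"
    by simp
  then show ?thesis
  proof (rule set_integrable_bound)
    show "set_borel_measurable lborel {0<..<pi} (\<lambda>x. sin x powr p)"
      by (simp add: set_borel_measurable_def)
    \<comment> \<open>A negative exponent reverses \<open>sin_ge_linear\<close>; each half of the
      interval uses the summand that is singular at its own endpoint.\<close>
    have "sin x powr p \<le> (2 / pi) powr p * (x powr p + (pi - x) powr p)"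
      if x: "0 < x" "x < pi" for x
    proof (cases "x \<le> pi / 2")
      case True
      have "sin x powr p \<le> (2 / pi * x) powr p"
        using False x True by (intro powr_mono2' sin_ge_linear) auto
      also have "\<dots> = (2 / pi) powr p * x powr p"
        using x by (intro powr_mult)
      finally show ?thesis
        by (simp add: algebra_simps add_increasing2)
    next
      case gt: False
      have "sin (pi - x) powr p \<le> (2 / pi * (pi - x)) powr p"
        using False x gt by (intro powr_mono2' sin_ge_linear) auto
      also have "\<dots> = (2 / pi) powr p * (pi - x) powr p"
        using x by (intro powr_mult)
      finally show ?thesis
        by (simp add: algebra_simps add_increasing)
    qed
    then show "AE x in lborel. x \<in> {0<..<pi} \<longrightarrow>
        norm (sin x powr p) \<le> norm ((2 / pi) powr p * (x powr p + (pi - x) powr p))"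
      by (auto simp: abs_mult)
  qed
qed

section \<open>The space-time integral\<close>

text \<open>Fubini's theorem; absolute integrability makes the iterated integral equal to the one
  over the product set.\<close>

lemma spacetime_integral_eq:
  assumes "spacetime_integrable f"
  shows "spacetime_integral f = (LINT z:({0..2 * pi} \<times> {0<..<pi})|lborel.
    (case z of (t, x) \<Rightarrow> f t x * (sin x)\<^sup>2 * (2 / pi) * (1 / pi)))"
proof -
  define F where "F z = indicat_real ({0..2 * pi} \<times> {0<..<pi}) z *
    (case z of (t, x) \<Rightarrow> f t x * (sin x)\<^sup>2 * (2 / pi) * (1 / pi))" for z
  have F: "F (t, x) = indicator {0..2 * pi} t * (indicator {0<..<pi} x * (f t x * (sin x)\<^sup>2 * (2 / pi))) * (1 / pi)"
    for t x by (simp add: F_def indicator_times)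
  have "integrable (lborel \<Otimes>\<^sub>M lborel) F"
    using assms unfolding spacetime_integrable_def set_integrable_def lborel_prod F_def by simp
  from lborel_pair.integral_fst'[OF this]
  have "(\<integral>t. (\<integral>x. F (t, x) \<partial>lborel) \<partial>lborel) = integral\<^sup>L lborel F"
    by (simp add: lborel_prod)
  then show ?thesis
    unfolding spacetime_integral_def set_lebesgue_integral_def F
    by (simp add: F_def[abs_def] mult.assoc)
qed

text \<open>Tonelli with t as the inner variable, because the available estimates are in time at
  fixed x. The weight sin^2 x raises the exponent to q + 2, so q > -3 is exactly what
  \<open>set_integrable_sin_powr\<close> requires.\<close>

lemma spacetime_integral_bound:
  assumes f: "(\<lambda>(t, x). f t x) \<in> borel_measurable borel"
    and c: "c \<ge> 0" and q: "q > -3"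
    and bound: "\<And>x. 0 < x \<Longrightarrow> x < pi \<Longrightarrow>
      (\<integral>\<^sup>+t\<in>{0..2 * pi}. ennreal \<bar>f t x\<bar> \<partial>lborel) \<le> ennreal (c * sin x powr q)"
  shows "spacetime_integrable f"
    and "\<bar>spacetime_integral f\<bar>
      \<le> c * (2 / pi * (1 / pi) * (LBINT x:{0<..<pi}. sin x powr (q + 2)))"
proof -
  have [measurable]: "(\<lambda>z. f (fst z) (snd z)) \<in> borel_measurable (lborel \<Otimes>\<^sub>M lborel)"
    using f by (simp add: split_beta borel_prod[symmetric])
  define F where "F z = indicat_real ({0..2 * pi} \<times> {0<..<pi}) z *
    (case z of (t, x) \<Rightarrow> f t x * (sin x)\<^sup>2 * (2 / pi) * (1 / pi))" for z
  define J where "J = 2 / pi * (1 / pi) * (LBINT x:{0<..<pi}. sin x powr (q + 2))"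
  have F: "F z = indicat_real {0..2 * pi} (fst z) * indicat_real {0<..<pi} (snd z) *
    (f (fst z) (snd z) * (sin (snd z))\<^sup>2 * (2 / pi) * (1 / pi))" for z
    by (cases z) (simp add: F_def indicator_times)
  have F_meas [measurable]: "F \<in> borel_measurable (lborel \<Otimes>\<^sub>M lborel)"
    unfolding F by measurable
  have sin_int: "set_integrable lborel {0<..<pi} (\<lambda>x. sin x powr (q + 2))"
    using q by (intro set_integrable_sin_powr) auto
  have inner: "(\<integral>\<^sup>+t. ennreal (norm (F (t, x))) \<partial>lborel)
      \<le> ennreal (c * (2 / pi * (1 / pi)) * (indicator {0<..<pi} x * sin x powr (q + 2)))" for x
  proof (cases "x \<in> {0<..<pi}")
    case True
    then have s: "sin x > 0"
      by (auto intro: sin_gt_zero)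
    have [measurable]: "(\<lambda>t. f t x) \<in> borel_measurable lborel"
      using measurable_compose[OF _ \<open>(\<lambda>z. f (fst z) (snd z)) \<in> _\<close>, of "\<lambda>t. (t, x)" lborel]
      by simp
    have "(\<integral>\<^sup>+t. ennreal (norm (F (t, x))) \<partial>lborel) =
        (\<integral>\<^sup>+t. ennreal ((sin x)\<^sup>2 * (2 / pi) * (1 / pi)) * (ennreal \<bar>f t x\<bar> * indicator {0..2 * pi} t) \<partial>lborel)"
      using True
      by (intro nn_integral_cong) (auto simp: F abs_mult ennreal_mult' indicator_def algebra_simps simp flip: ennreal_mult)
    also have "\<dots> = ennreal ((sin x)\<^sup>2 * (2 / pi) * (1 / pi)) *
        (\<integral>\<^sup>+t\<in>{0..2 * pi}. ennreal \<bar>f t x\<bar> \<partial>lborel)"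
      by (intro nn_integral_cmult) measurable
    also have "\<dots> \<le> ennreal ((sin x)\<^sup>2 * (2 / pi) * (1 / pi)) * ennreal (c * sin x powr q)"
      using True by (intro mult_left_mono bound) auto
    also have "\<dots> = ennreal ((sin x)\<^sup>2 * (2 / pi) * (1 / pi) * (c * sin x powr q))"
      by (rule ennreal_mult'[symmetric]) auto
    also have "(sin x)\<^sup>2 * (2 / pi) * (1 / pi) * (c * sin x powr q) =
        c * (2 / pi * (1 / pi)) * (indicator {0<..<pi} x * sin x powr (q + 2))"
      using True s by (simp add: powr_add)
    finally show ?thesis .
  qed (simp add: F)
  have "(\<integral>\<^sup>+z. ennreal (norm (F z)) \<partial>(lborel \<Otimes>\<^sub>M lborel)) =
      (\<integral>\<^sup>+x. (\<integral>\<^sup>+t. ennreal (norm (F (t, x))) \<partial>lborel) \<partial>lborel)"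
    by (rule lborel_pair.nn_integral_snd[symmetric]) measurable
  also have "\<dots> \<le> (\<integral>\<^sup>+x. ennreal (c * (2 / pi * (1 / pi)) * (indicator {0<..<pi} x * sin x powr (q + 2))) \<partial>lborel)"
    by (intro nn_integral_mono inner)
  also have "\<dots> = ennreal (c * J)"
  proof (subst nn_integral_eq_integral)
    show "integrable lborel (\<lambda>x. c * (2 / pi * (1 / pi)) * (indicator {0<..<pi} x * sin x powr (q + 2)))"
      using sin_int unfolding set_integrable_def by (intro integrable_mult_right) simp
    show "AE x in lborel. 0 \<le> c * (2 / pi * (1 / pi)) * (indicator {0<..<pi} x * sin x powr (q + 2))"
      using c by simp
  qed (simp add: J_def set_lebesgue_integral_def mult.assoc)
  finally have le: "(\<integral>\<^sup>+z. ennreal (norm (F z)) \<partial>(lborel \<Otimes>\<^sub>M lborel)) \<le> ennreal (c * J)" .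
  then have int: "integrable (lborel \<Otimes>\<^sub>M lborel) F"
    by (intro integrableI_bounded) (auto intro: order_le_less_trans)
  then show si: "spacetime_integrable f"
    unfolding spacetime_integrable_def set_integrable_def lborel_prod F_def by simp
  have "spacetime_integral f = integral\<^sup>L (lborel \<Otimes>\<^sub>M lborel) F"
    by (simp add: spacetime_integral_eq[OF si] set_lebesgue_integral_def lborel_prod F_def[abs_def])
  then have "ennreal \<bar>spacetime_integral f\<bar> \<le> ennreal (c * J)"
    using integral_norm_bound_ennreal[OF int] le by simp
  moreover have "c * J \<ge> 0"
    using c by (simp add: J_def set_lebesgue_integral_def)
  ultimately show "\<bar>spacetime_integral f\<bar> \<le> c * (2 / pi * (1 / pi) * (LBINT x:{0<..<pi}. sin x powr (q + 2)))"
    by (simp add: J_def)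
qed

section \<open>Bounds for the eigenfunctions\<close>

lemma freq_ge_1 [simp]: "freq j \<ge> 1"
  and freq_pos [simp]: "freq j > 0"
  and freq_nonneg [simp]: "freq j \<ge> 0"
  and freq_neq_0 [simp]: "freq j \<noteq> 0"
  by (simp_all add: freq_def)

lemma abs_sin_mult_le: "\<bar>sin (real n * x)\<bar> \<le> real n * \<bar>sin x\<bar>"
proof (induction n)
  case (Suc n)
  have "\<bar>sin (real (Suc n) * x)\<bar> \<le> \<bar>sin (real n * x)\<bar> * \<bar>cos x\<bar> + \<bar>cos (real n * x)\<bar> * \<bar>sin x\<bar>"
    by (simp add: distrib_right sin_add add.commute[of x] abs_triangle_ineq flip: abs_mult)
  also have "\<dots> \<le> \<bar>sin (real n * x)\<bar> * 1 + 1 * \<bar>sin x\<bar>"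
    by (intro add_mono mult_mono) auto
  finally show ?case
    using Suc by (simp add: distrib_right)
qed simp

text \<open>With y = omega_j sin x, the bounds omega_j and 1 / sin x on the eigenfunction together
  say that |sin (omega_j x)| <= min y 1, and min y 1 <= y^\<theta> whenever 0 <= \<theta> <=
  1.\<close>

lemma abs_eigf_le:
  assumes x: "0 < x" "x < pi" and \<theta>: "0 \<le> \<theta>" "\<theta> \<le> 1"
  shows "\<bar>eigf j x\<bar> \<le> freq j powr \<theta> * sin x powr (\<theta> - 1)"
proof -
  have s: "sin x > 0"
    using x by (rule sin_gt_zero)
  define y where "y = freq j * sin x"
  have y: "y > 0"
    using s by (simp add: y_def)
  have le: "\<bar>sin (freq j * x)\<bar> \<le> y"
    using abs_sin_mult_le[of "Suc j" x] s by (simp add: y_def freq_def add.commute)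
  have "\<bar>sin (freq j * x)\<bar> \<le> y powr \<theta>"
  proof (cases "y \<le> 1")
    case True
    then have "y powr 1 \<le> y powr \<theta>"
      using y \<theta> by (intro powr_mono') auto
    then show ?thesis
      using le y by simp
  next
    case False
    then have "1 \<le> y powr \<theta>"
      using \<theta> by (simp add: ge_one_powr_ge_zero)
    then show ?thesis
      using abs_sin_le_one order_trans by blast
  qed
  also have "\<dots> = freq j powr \<theta> * sin x powr (\<theta> - 1) * sin x"
    using s by (simp add: y_def powr_mult powr_diff)
  finally show ?thesis
    using s by (simp add: eigf_def divide_le_eq)
qed

lemma summable_freq_powr:
  assumes "\<alpha> > 1 / 2"
  shows "summable (\<lambda>j. freq j powr (- 2 * \<alpha>))"
proof -
  have "summable (\<lambda>j. real (Suc j) powr (- 2 * \<alpha>))"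
    unfolding summable_Suc_iff[of "\<lambda>j. real j powr (- 2 * \<alpha>)"]
    using assms by (subst summable_real_powr_iff) auto
  then show ?thesis
    by (simp add: freq_def add.commute)
qed

section \<open>Coefficient norms and pointwise bounds\<close>

lemma freq_powr_square: "(freq j powr r)\<^sup>2 = freq j powr (2 * r)"
  by (simp add: power2_eq_square flip: powr_add)

lemma V_norm_nonneg: "v \<in> V_space s \<Longrightarrow> V_norm s v \<ge> 0"
  unfolding V_norm_def V_space_def by (auto intro!: suminf_nonneg)

lemma V_norm_square:
  "v \<in> V_space s \<Longrightarrow> (V_norm s v)\<^sup>2 = (\<Sum>j. \<bar>v j\<bar>\<^sup>2 * freq j powr (2 * s))"
  unfolding V_norm_def V_space_def by (auto intro!: real_sqrt_pow2 suminf_nonneg)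

lemma sum_le_V_norm_square:
  assumes "v \<in> V_space s"
  shows "(\<Sum>j<N. \<bar>v j\<bar>\<^sup>2 * freq j powr (2 * s)) \<le> (V_norm s v)\<^sup>2"
  unfolding V_norm_square[OF assms] using assms
  by (intro sum_le_suminf) (auto simp: V_space_def)

text \<open>The norm is a weighted square sum of the |v_j|, so termwise domination suffices. This
  serves for lowering the order, for truncation and for moving weights between factors.\<close>

lemma V_space_dominated:
  assumes v: "v \<in> V_space s" and le: "\<And>j. \<bar>w j\<bar> * freq j powr r \<le> \<bar>v j\<bar> * freq j powr s"
  shows "w \<in> V_space r" and "V_norm r w \<le> V_norm s v"
proof -
  have sq: "\<bar>w j\<bar>\<^sup>2 * freq j powr (2 * r) \<le> \<bar>v j\<bar>\<^sup>2 * freq j powr (2 * s)" for j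
    using power_mono[OF le, of j 2] by (simp add: power_mult_distrib freq_powr_square)
  have v': "summable (\<lambda>j. \<bar>v j\<bar>\<^sup>2 * freq j powr (2 * s))"
    using v by (simp add: V_space_def)
  have w': "summable (\<lambda>j. \<bar>w j\<bar>\<^sup>2 * freq j powr (2 * r))"
    using sq by (intro summable_comparison_test'[OF v', of 0]) (auto simp: abs_mult)
  show "w \<in> V_space r"
    using w' by (simp add: V_space_def)
  show "V_norm r w \<le> V_norm s v"
    unfolding V_norm_def using sq v' w' by (intro real_sqrt_le_mono suminf_le) auto
qed

lemma V_norm_mono:
  assumes "v \<in> V_space s" "r \<le> s"
  shows "v \<in> V_space r" and "V_norm r v \<le> V_norm s v"
proof -
  have "\<bar>v j\<bar> * freq j powr r \<le> \<bar>v j\<bar> * freq j powr s" for j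
    using assms(2) by (intro mult_left_mono powr_mono) auto
  from V_space_dominated[OF assms(1) this] show "v \<in> V_space r" and "V_norm r v \<le> V_norm s v"
    by auto
qed

text \<open>The l^2 norm of omega_j^(-\<alpha>), finite for \<alpha> > 1/2: the constant that
  Cauchy-Schwarz gives when a weighted l^2 norm is to control an l^1 norm.\<close>

definition sobolev_const :: "real \<Rightarrow> real" where
  "sobolev_const \<alpha> = sqrt (\<Sum>j. freq j powr (- 2 * \<alpha>))"

lemma sobolev_const_pos:
  assumes "\<alpha> > 1 / 2"
  shows "sobolev_const \<alpha> > 0"
  unfolding sobolev_const_def
  using summable_freq_powr[OF assms] by (auto intro!: suminf_pos)

text \<open>Cauchy-Schwarz against omega_j^(-(s - \<theta>)), which is square summable because s -
  \<theta> > 1/2. The bound is proved for partial sums, which yields both convergence and the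
  estimate.\<close>

lemma V_space_weighted_sum:
  assumes v: "v \<in> V_space s" and \<theta>: "\<theta> < s - 1 / 2"
  shows "summable (\<lambda>j. \<bar>v j\<bar> * freq j powr \<theta>)"
    and "(\<Sum>j. \<bar>v j\<bar> * freq j powr \<theta>) \<le> sobolev_const (s - \<theta>) * V_norm s v"
proof -
  have sf: "summable (\<lambda>j. freq j powr (- 2 * (s - \<theta>)))"
    using \<theta> by (intro summable_freq_powr) auto
  have K: "(sobolev_const (s - \<theta>))\<^sup>2 = (\<Sum>j. freq j powr (- 2 * (s - \<theta>)))"
    unfolding sobolev_const_def by (intro real_sqrt_pow2 suminf_nonneg sf) auto
  have partial: "(\<Sum>j<N. \<bar>v j\<bar> * freq j powr \<theta>) \<le> sobolev_const (s - \<theta>) * V_norm s v" for N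
  proof (rule power2_le_imp_le)
    have "(\<Sum>j<N. \<bar>v j\<bar> * freq j powr \<theta>)\<^sup>2 =
        (\<Sum>j<N. freq j powr (- (s - \<theta>)) * (\<bar>v j\<bar> * freq j powr s))\<^sup>2"
      by (intro arg_cong[where f = "\<lambda>x. x\<^sup>2"] sum.cong) (auto simp: powr_diff powr_minus field_simps)
    also have "\<dots> \<le> (\<Sum>j<N. (freq j powr (- (s - \<theta>)))\<^sup>2) * (\<Sum>j<N. (\<bar>v j\<bar> * freq j powr s)\<^sup>2)"
      by (rule Cauchy_Schwarz_ineq_sum)
    also have "\<dots> = (\<Sum>j<N. freq j powr (- 2 * (s - \<theta>))) * (\<Sum>j<N. \<bar>v j\<bar>\<^sup>2 * freq j powr (2 * s))"
      by (simp only: power_mult_distrib freq_powr_square) simp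
    also have "\<dots> \<le> (sobolev_const (s - \<theta>))\<^sup>2 * (V_norm s v)\<^sup>2"
      unfolding K by (intro mult_mono sum_le_V_norm_square v sum_le_suminf sf suminf_nonneg sum_nonneg) auto
    finally show "(\<Sum>j<N. \<bar>v j\<bar> * freq j powr \<theta>)\<^sup>2 \<le> (sobolev_const (s - \<theta>) * V_norm s v)\<^sup>2"
      by (simp add: power_mult_distrib)
    show "0 \<le> sobolev_const (s - \<theta>) * V_norm s v"
      using \<theta> by (intro mult_nonneg_nonneg less_imp_le[OF sobolev_const_pos] V_norm_nonneg v) auto
  qed
  show "summable (\<lambda>j. \<bar>v j\<bar> * freq j powr \<theta>)"
    by (rule summableI_nonneg_bounded[OF _ partial]) auto
  then show "(\<Sum>j. \<bar>v j\<bar> * freq j powr \<theta>) \<le> sobolev_const (s - \<theta>) * V_norm s v"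
    using partial by (intro suminf_le_const) auto
qed

lemma V_space_summable_abs:
  assumes "v \<in> V_space s" "s > 1 / 2"
  shows "summable (\<lambda>j. \<bar>v j\<bar>)"
  using V_space_weighted_sum(1)[OF assms(1), of 0] assms(2) by simp

text \<open>The sup bound in time: the cosines are bounded by 1 and the eigenfunctions by
  \<open>abs_eigf_le\<close>, which leaves a weighted l^1 sum of the coefficients.\<close>

lemma abs_V_fun_le:
  assumes v: "v \<in> V_space s" and \<theta>: "0 \<le> \<theta>" "\<theta> \<le> 1" "\<theta> < s - 1 / 2" and x: "0 < x" "x < pi"
  shows "\<bar>V_fun v t x\<bar> \<le> sobolev_const (s - \<theta>) * V_norm s v * sin x powr (\<theta> - 1)"
proof -
  note sum = V_space_weighted_sum[OF v \<theta>(3)]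
  have summand: "\<bar>v j * cos (freq j * t) * eigf j x\<bar> \<le> \<bar>v j\<bar> * freq j powr \<theta> * sin x powr (\<theta> - 1)" for j
  proof -
    have "\<bar>v j * cos (freq j * t) * eigf j x\<bar> \<le> \<bar>v j\<bar> * 1 * (freq j powr \<theta> * sin x powr (\<theta> - 1))"
      unfolding abs_mult using abs_eigf_le[OF x \<theta>(1,2)] by (intro mult_mono) auto
    then show ?thesis
      by (simp add: mult.assoc)
  qed
  have s2: "summable (\<lambda>j. \<bar>v j\<bar> * freq j powr \<theta> * sin x powr (\<theta> - 1))"
    using sum(1) by (rule summable_mult2)
  have s1: "summable (\<lambda>j. \<bar>v j * cos (freq j * t) * eigf j x\<bar>)"
    by (rule summable_comparison_test'[OF s2, of 0]) (use summand in auto)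
  have "\<bar>V_fun v t x\<bar> \<le> (\<Sum>j. \<bar>v j * cos (freq j * t) * eigf j x\<bar>)"
    unfolding V_fun_def by (rule summable_rabs[OF s1])
  also have "\<dots> \<le> (\<Sum>j. \<bar>v j\<bar> * freq j powr \<theta> * sin x powr (\<theta> - 1))"
    by (intro suminf_le summand s1 s2)
  also have "\<dots> = (\<Sum>j. \<bar>v j\<bar> * freq j powr \<theta>) * sin x powr (\<theta> - 1)"
    by (rule suminf_mult2[OF sum(1), symmetric])
  also have "\<dots> \<le> sobolev_const (s - \<theta>) * V_norm s v * sin x powr (\<theta> - 1)"
    by (intro mult_right_mono sum(2)) auto
  finally show ?thesis .
qed

section \<open>Parseval in time\<close>

lemma borel_measurable_fst_snd [measurable]:
  "fst \<in> borel_measurable (borel :: (real \<times> real) measure)"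
  "snd \<in> borel_measurable (borel :: (real \<times> real) measure)"
  by (simp_all add: borel_prod[symmetric])

lemma borel_measurable_V_fun [measurable]:
  "(\<lambda>z. V_fun v (fst z) (snd z)) \<in> borel_measurable borel"
  unfolding V_fun_def eigf_def by measurable

lemma borel_measurable_V_fun_time [measurable]: "(\<lambda>t. V_fun v t x) \<in> borel_measurable borel"
  unfolding V_fun_def by measurable

lemma set_lebesgue_integral_sum:
  fixes f :: "'i \<Rightarrow> 'a \<Rightarrow> real"
  assumes "\<And>i. i \<in> I \<Longrightarrow> set_integrable M A (f i)"
  shows "(LINT x:A|M. (\<Sum>i\<in>I. f i x)) = (\<Sum>i\<in>I. LINT x:A|M. f i x)"
  using assms unfolding set_lebesgue_integral_def set_integrable_def scaleR_sum_right
  by (rule Bochner_Integration.integral_sum)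

lemma set_integrable_continuous:
  fixes f :: "real \<Rightarrow> real"
  assumes "continuous_on {a..b} f"
  shows "set_integrable lborel {a..b} f"
  unfolding set_integrable_def using assms by (intro borel_integrable_compact) auto

lemma integral_cos_int:
  "(LBINT t:{0..2 * pi}. cos (of_int m * t)) = (if m = 0 then 2 * pi else 0)"
proof (cases "m = 0")
  case False
  define F where "F t = sin (of_int m * t) / of_int m" for t :: real
  have "(LBINT t. indicator {0..2 * pi} t *\<^sub>R cos (of_int m * t)) = F (2 * pi) - F 0"
    by (rule integral_FTC_Icc)
      (use False in \<open>auto simp: F_def has_real_derivative_iff_has_vector_derivative[symmetric]
        intro!: derivative_eq_intros continuous_intros\<close>)
  also have "\<dots> = 0"
    using sin_npi_int[of "2 * m"] by (simp add: F_def mult.assoc mult.left_commute mult.commute)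
  finally show ?thesis
    using False by (simp add: set_lebesgue_integral_def)
qed (simp add: set_lebesgue_integral_def)

lemma integral_cos_freq_mult:
  "(LBINT t:{0..2 * pi}. cos (freq j * t) * cos (freq k * t)) = (if j = k then pi else 0)"
proof -
  \<comment> \<open>The sum frequency j + k + 2 is never 0, so only the difference frequency can
    contribute, and it does so exactly for j = k.\<close>
  have "cos (freq j * t) * cos (freq k * t) =
      cos (of_int (int j - int k) * t) * (1 / 2) + cos (of_int (int j + int k + 2) * t) * (1 / 2)" for t
    by (simp add: cos_times_cos freq_def algebra_simps add_divide_distrib)
  then have "(LBINT t:{0..2 * pi}. cos (freq j * t) * cos (freq k * t)) =
      (LBINT t:{0..2 * pi}. cos (of_int (int j - int k) * t) * (1 / 2) +
        cos (of_int (int j + int k + 2) * t) * (1 / 2))"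
    by simp
  also have "\<dots> = (LBINT t:{0..2 * pi}. cos (of_int (int j - int k) * t)) * (1 / 2) +
      (LBINT t:{0..2 * pi}. cos (of_int (int j + int k + 2) * t)) * (1 / 2)"
    by (subst set_integral_add(2))
      (auto intro!: set_integrable_continuous continuous_intros)
  also have "\<dots> = (if j = k then pi else 0)"
    unfolding integral_cos_int by auto
  finally show ?thesis .
qed

text \<open>Orthogonality evaluates the integral for partial sums. Absolute summability bounds these
  uniformly by a constant \<open>A\<close>, so dominated convergence on the bounded time interval
  carries the bound over to the full series.\<close>

lemma integral_cos_series_square:
  fixes c :: "nat \<Rightarrow> real"
  assumes c: "summable (\<lambda>j. \<bar>c j\<bar>)" and B: "\<And>N. (\<Sum>j<N. (c j)\<^sup>2) \<le> B"
  shows "(\<integral>\<^sup>+t\<in>{0..2 * pi}. ennreal ((\<Sum>j. c j * cos (freq j * t))\<^sup>2) \<partial>lborel) \<le> ennreal (pi * B)"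
proof -
  define S where "S N t = (\<Sum>j<N. c j * cos (freq j * t))" for N t
  define S' where "S' t = (\<Sum>j. c j * cos (freq j * t))" for t
  define A where "A = (\<Sum>j. \<bar>c j\<bar>)"
  have summand: "\<bar>c j * cos (freq j * t)\<bar> \<le> \<bar>c j\<bar>" for j t
    by (simp add: abs_mult mult_left_le)
  have sm: "summable (\<lambda>j. c j * cos (freq j * t))" for t
    by (rule summable_comparison_test'[OF c, of 0]) (use summand in auto)
  have lim: "(\<lambda>N. S N t) \<longlonglongrightarrow> S' t" for t
    unfolding S_def S'_def by (rule summable_LIMSEQ[OF sm])
  have bd: "\<bar>S N t\<bar> \<le> A" for N t
  proof -
    have "\<bar>S N t\<bar> \<le> (\<Sum>j<N. \<bar>c j\<bar>)"
      unfolding S_def by (rule order_trans[OF sum_abs]) (intro sum_mono summand)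
    also have "\<dots> \<le> A"
      unfolding A_def by (intro sum_le_suminf c) auto
    finally show ?thesis .
  qed
  have [measurable]: "S N \<in> borel_measurable borel" "S' \<in> borel_measurable borel" for N
    unfolding S_def S'_def by measurable
  have lim': "AE t in lborel. (\<lambda>N. indicator {0..2 * pi} t *\<^sub>R (S N t)\<^sup>2) \<longlonglongrightarrow> indicator {0..2 * pi} t *\<^sub>R (S' t)\<^sup>2"
    by (intro AE_I2 tendsto_intros lim)
  have bd': "AE t in lborel. norm (indicator {0..2 * pi} t *\<^sub>R (S N t)\<^sup>2) \<le> indicator {0..2 * pi} t *\<^sub>R A\<^sup>2" for N
  proof (rule AE_I2)
    show "norm (indicator {0..2 * pi} t *\<^sub>R (S N t)\<^sup>2) \<le> indicator {0..2 * pi} t *\<^sub>R A\<^sup>2" for t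
      using power_mono[OF bd[of N t], of 2] by (simp add: indicator_def)
  qed
  have A_int: "integrable lborel (\<lambda>t. indicator {0..2 * pi} t *\<^sub>R A\<^sup>2)"
    by simp
  have meas: "(\<lambda>t. indicator {0..2 * pi} t *\<^sub>R (S' t)\<^sup>2) \<in> borel_measurable lborel"
    "(\<lambda>t. indicator {0..2 * pi} t *\<^sub>R (S N t)\<^sup>2) \<in> borel_measurable lborel" for N
    by measurable
  note dct = integrable_dominated_convergence[OF meas A_int lim' bd']
    integral_dominated_convergence[OF meas A_int lim' bd']
  have fin: "(LBINT t. indicator {0..2 * pi} t *\<^sub>R (S N t)\<^sup>2) = pi * (\<Sum>j<N. (c j)\<^sup>2)" for N
  proof -
    have "(LBINT t. indicator {0..2 * pi} t *\<^sub>R (S N t)\<^sup>2) =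
        (LBINT t:{0..2 * pi}. (\<Sum>j<N. \<Sum>k<N. (c j * c k) * (cos (freq j * t) * cos (freq k * t))))"
      unfolding set_lebesgue_integral_def S_def power2_eq_square sum_product by (simp add: mult_ac)
    also have "\<dots> = (\<Sum>j<N. \<Sum>k<N. (c j * c k) * (LBINT t:{0..2 * pi}. cos (freq j * t) * cos (freq k * t)))"
    proof -
      have int: "set_integrable lborel {0..2 * pi} (\<lambda>t. (c j * c k) * (cos (freq j * t) * cos (freq k * t)))" for j k
        by (intro set_integrable_continuous continuous_intros)
      have "set_integrable lborel {0..2 * pi} (\<lambda>t. \<Sum>k<N. (c j * c k) * (cos (freq j * t) * cos (freq k * t)))" for j
        by (intro set_integrable_continuous continuous_intros)
      then show ?thesis
        by (simp only: set_lebesgue_integral_sum int set_integral_mult_right)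
    qed
    also have "\<dots> = pi * (\<Sum>j<N. (c j)\<^sup>2)"
      unfolding integral_cos_freq_mult
      by (simp add: if_distrib[of "(*) _"] sum_distrib_left power2_eq_square mult_ac cong: if_cong)
    finally show ?thesis .
  qed
  have le: "(LBINT t. indicator {0..2 * pi} t *\<^sub>R (S' t)\<^sup>2) \<le> pi * B"
    by (rule LIMSEQ_le_const2[OF dct(2)]) (auto simp: fin intro!: B simp del: real_scaleR_def)
  have "(\<integral>\<^sup>+t\<in>{0..2 * pi}. ennreal ((S' t)\<^sup>2) \<partial>lborel) =
      (\<integral>\<^sup>+t. ennreal (indicator {0..2 * pi} t *\<^sub>R (S' t)\<^sup>2) \<partial>lborel)"
    by (intro nn_integral_cong) (auto simp: indicator_def)
  also have "\<dots> = ennreal (LBINT t. indicator {0..2 * pi} t *\<^sub>R (S' t)\<^sup>2)"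
    by (intro nn_integral_eq_integral dct(1)) auto
  also have "\<dots> \<le> ennreal (pi * B)"
    by (intro ennreal_leI le)
  finally show ?thesis
    unfolding S'_def .
qed

text \<open>Parseval in t for the coefficients v_j e_j(x), with \<open>abs_eigf_le\<close> at
  exponent \<sigma>; unlike the sup bound, it loses no half derivative. Summability is assumed
  separately since an order \<sigma> <= 1/2 does not provide it.\<close>

lemma V_fun_L2_time:
  assumes v: "v \<in> V_space \<sigma>" "summable (\<lambda>j. \<bar>v j\<bar>)" and \<sigma>: "0 \<le> \<sigma>" "\<sigma> \<le> 1" and x: "0 < x" "x < pi"
  shows "(\<integral>\<^sup>+t\<in>{0..2 * pi}. ennreal ((V_fun v t x)\<^sup>2) \<partial>lborel)
    \<le> ennreal (pi * (V_norm \<sigma> v * sin x powr (\<sigma> - 1))\<^sup>2)"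
proof -
  have s: "sin x > 0"
    using x by (rule sin_gt_zero)
  have "\<bar>v j * eigf j x\<bar> \<le> \<bar>v j\<bar> * (1 / sin x)" for j
    unfolding abs_mult using abs_eigf_le[OF x, of 0 j] s
    by (intro mult_left_mono) (auto simp: powr_minus_divide)
  then have c: "summable (\<lambda>j. \<bar>v j * eigf j x\<bar>)"
    by (intro summable_comparison_test'[OF summable_mult2[OF v(2), of "1 / sin x"], of 0]) auto
  have B: "(\<Sum>j<N. (v j * eigf j x)\<^sup>2) \<le> (V_norm \<sigma> v * sin x powr (\<sigma> - 1))\<^sup>2" for N
  proof -
    have "(v j * eigf j x)\<^sup>2 \<le> \<bar>v j\<bar>\<^sup>2 * freq j powr (2 * \<sigma>) * (sin x powr (\<sigma> - 1))\<^sup>2" for j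
    proof -
      have "\<bar>v j * eigf j x\<bar> \<le> \<bar>v j\<bar> * (freq j powr \<sigma> * sin x powr (\<sigma> - 1))"
        unfolding abs_mult by (intro mult_left_mono abs_eigf_le x \<sigma>) auto
      from power_mono[OF this, of 2] show ?thesis
        by (simp add: power_mult_distrib freq_powr_square)
    qed
    then have "(\<Sum>j<N. (v j * eigf j x)\<^sup>2) \<le>
        (\<Sum>j<N. \<bar>v j\<bar>\<^sup>2 * freq j powr (2 * \<sigma>)) * (sin x powr (\<sigma> - 1))\<^sup>2"
      by (simp only: sum_distrib_right) (intro sum_mono)
    also have "\<dots> \<le> (V_norm \<sigma> v)\<^sup>2 * (sin x powr (\<sigma> - 1))\<^sup>2"
      by (intro mult_right_mono sum_le_V_norm_square v) auto
    finally show ?thesis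
      by (simp add: power_mult_distrib)
  qed
  show ?thesis
    using integral_cos_series_square[OF c B] by (simp add: V_fun_def mult_ac)
qed

section \<open>Multilinear estimate without frequency interactions\<close>

lemma ennreal_le_of_square_le:
  fixes X :: ennreal
  assumes "X\<^sup>2 \<le> ennreal (c\<^sup>2)" "c \<ge> 0"
  shows "X \<le> ennreal c"
proof (cases X)
  case (real r)
  then have "r\<^sup>2 \<le> c\<^sup>2"
    using assms by (simp add: ennreal_power)
  then show ?thesis
    using real assms(2) by (auto intro: ennreal_leI power2_le_imp_le)
next
  case top
  then show ?thesis
    using assms(1) by (simp add: power2_eq_square top_unique ennreal_mult_eq_top_iff)
qed

lemma borel_measurable_prod_V_fun:
  "(\<lambda>(t, x). \<Prod>n\<in>I. V_fun (v n) t x) \<in> borel_measurable borel"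
  unfolding split_beta by measurable

text \<open>Cauchy-Schwarz in time and the two L^2 bounds of \<open>V_fun_L2_time\<close>.
  Nonnegative integrals are used throughout, so no integrability has to be known beforehand.\<close>

lemma V_fun_bilinear_time:
  assumes a: "a \<in> V_space \<sigma>" "summable (\<lambda>j. \<bar>a j\<bar>)" "0 \<le> \<sigma>" "\<sigma> \<le> 1"
    and b: "b \<in> V_space \<tau>" "summable (\<lambda>j. \<bar>b j\<bar>)" "0 \<le> \<tau>" "\<tau> \<le> 1"
    and x: "0 < x" "x < pi"
  shows "(\<integral>\<^sup>+t\<in>{0..2 * pi}. ennreal (\<bar>V_fun a t x\<bar> * \<bar>V_fun b t x\<bar>) \<partial>lborel)
    \<le> ennreal (pi * (V_norm \<sigma> a * V_norm \<tau> b * sin x powr (\<sigma> + \<tau> - 2)))"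
proof (rule ennreal_le_of_square_le)
  have "(\<integral>\<^sup>+t\<in>{0..2 * pi}. ennreal (\<bar>V_fun a t x\<bar> * \<bar>V_fun b t x\<bar>) \<partial>lborel)\<^sup>2 =
      (\<integral>\<^sup>+t. (ennreal \<bar>V_fun a t x\<bar> * indicator {0..2 * pi} t) * (ennreal \<bar>V_fun b t x\<bar> * indicator {0..2 * pi} t) \<partial>lborel)\<^sup>2"
    by (intro arg_cong[where f = "\<lambda>x. x\<^sup>2"] nn_integral_cong) (auto simp: ennreal_mult' indicator_def)
  also have "\<dots> \<le> (\<integral>\<^sup>+t. (ennreal \<bar>V_fun a t x\<bar> * indicator {0..2 * pi} t)\<^sup>2 \<partial>lborel) *
      (\<integral>\<^sup>+t. (ennreal \<bar>V_fun b t x\<bar> * indicator {0..2 * pi} t)\<^sup>2 \<partial>lborel)"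
    by (rule Cauchy_Schwarz_nn_integral) measurable
  also have "\<dots> = (\<integral>\<^sup>+t\<in>{0..2 * pi}. ennreal ((V_fun a t x)\<^sup>2) \<partial>lborel) *
      (\<integral>\<^sup>+t\<in>{0..2 * pi}. ennreal ((V_fun b t x)\<^sup>2) \<partial>lborel)"
    by (intro arg_cong2[where f = "(*)"] nn_integral_cong) (auto simp: ennreal_power indicator_def)
  also have "\<dots> \<le> ennreal (pi * (V_norm \<sigma> a * sin x powr (\<sigma> - 1))\<^sup>2) *
      ennreal (pi * (V_norm \<tau> b * sin x powr (\<tau> - 1))\<^sup>2)"
    by (intro mult_mono V_fun_L2_time assms) auto
  also have "\<dots> = ennreal ((pi * (V_norm \<sigma> a * V_norm \<tau> b * (sin x powr (\<sigma> - 1) * sin x powr (\<tau> - 1))))\<^sup>2)"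
    by (subst ennreal_mult[symmetric], simp, simp) (simp add: power2_eq_square mult_ac)
  also have "sin x powr (\<sigma> - 1) * sin x powr (\<tau> - 1) = sin x powr (\<sigma> + \<tau> - 2)"
    by (simp add: powr_add[symmetric])
  finally show "(\<integral>\<^sup>+t\<in>{0..2 * pi}. ennreal (\<bar>V_fun a t x\<bar> * \<bar>V_fun b t x\<bar>) \<partial>lborel)\<^sup>2 \<le>
      ennreal ((pi * (V_norm \<sigma> a * V_norm \<tau> b * sin x powr (\<sigma> + \<tau> - 2)))\<^sup>2)" .
  show "0 \<le> pi * (V_norm \<sigma> a * V_norm \<tau> b * sin x powr (\<sigma> + \<tau> - 2))"
    using assms by (auto intro!: mult_nonneg_nonneg V_norm_nonneg)
qed

text \<open>The factors in \<open>S\<close> are bounded uniformly in time, those at \<open>a\<close>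
  and \<open>b\<close> in L^2. The powers of sin x add up to card S (\<theta> - 1) + \<sigma> +
  \<tau> - 2; with the weight sin^2 x the exponent must exceed -1, which is the last
  hypothesis.\<close>

proposition spacetime_multilinear_estimate:
  assumes S: "finite S" "a \<notin> S" "b \<notin> S" "a \<noteq> b"
    and \<theta>: "0 \<le> \<theta>" "\<theta> \<le> 1" "\<theta> < s - 1 / 2"
    and \<sigma>: "0 \<le> \<sigma>" "\<sigma> \<le> 1" and \<tau>: "0 \<le> \<tau>" "\<tau> \<le> 1"
    and exponent: "real (card S) * (\<theta> - 1) + \<sigma> + \<tau> > -1"
  shows "\<exists>C>0. \<forall>v. (\<forall>n\<in>S. v n \<in> V_space s) \<and>
      v a \<in> V_space \<sigma> \<and> summable (\<lambda>j. \<bar>v a j\<bar>) \<and> v b \<in> V_space \<tau> \<and> summable (\<lambda>j. \<bar>v b j\<bar>) \<longrightarrow>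
      spacetime_integrable (\<lambda>t x. \<Prod>n\<in>insert a (insert b S). V_fun (v n) t x) \<and>
      \<bar>spacetime_integral (\<lambda>t x. \<Prod>n\<in>insert a (insert b S). V_fun (v n) t x)\<bar>
        \<le> C * ((\<Prod>n\<in>S. V_norm s (v n)) * V_norm \<sigma> (v a) * V_norm \<tau> (v b))"
proof -
  define K where "K = sobolev_const (s - \<theta>)"
  have K: "K > 0"
    unfolding K_def using \<theta> by (intro sobolev_const_pos) auto
  define q where "q = real (card S) * (\<theta> - 1) + (\<sigma> + \<tau> - 2)"
  have q: "q > -3"
    using exponent by (simp add: q_def)
  define J where "J = 2 / pi * (1 / pi) * (LBINT x:{0<..<pi}. sin x powr (q + 2))"
  have J: "J \<ge> 0"
    by (simp add: J_def set_lebesgue_integral_def)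
  \<comment> \<open>Adding 1 makes the constant positive, as only \<open>J\<close> >= 0 is known
    here.\<close>
  define C where "C = K ^ card S * pi * (J + 1)"
  have "C > 0"
    using K J by (simp add: C_def)
  moreover have "spacetime_integrable f \<and> \<bar>spacetime_integral f\<bar> \<le>
      C * ((\<Prod>n\<in>S. V_norm s (v n)) * V_norm \<sigma> (v a) * V_norm \<tau> (v b))"
    if vS: "\<forall>n\<in>S. v n \<in> V_space s" and va: "v a \<in> V_space \<sigma>" "summable (\<lambda>j. \<bar>v a j\<bar>)"
      and vb: "v b \<in> V_space \<tau>" "summable (\<lambda>j. \<bar>v b j\<bar>)"
      and f_def: "f = (\<lambda>t x. \<Prod>n\<in>insert a (insert b S). V_fun (v n) t x)" for v f
  proof -
    define P where "P = (\<Prod>n\<in>S. V_norm s (v n)) * V_norm \<sigma> (v a) * V_norm \<tau> (v b)"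
    have P: "P \<ge> 0"
      using vS va vb by (auto simp: P_def intro!: mult_nonneg_nonneg prod_nonneg V_norm_nonneg)
    define c where "c = K ^ card S * pi * P"
    have c: "c \<ge> 0"
      using K P by (simp add: c_def)
    have meas: "(\<lambda>(t, x). f t x) \<in> borel_measurable borel"
      unfolding f_def by (rule borel_measurable_prod_V_fun)
    have bound: "(\<integral>\<^sup>+t\<in>{0..2 * pi}. ennreal \<bar>f t x\<bar> \<partial>lborel) \<le> ennreal (c * sin x powr q)"
      if x: "0 < x" "x < pi" for x
    proof -
      have s: "sin x > 0"
        using x by (rule sin_gt_zero)
      \<comment> \<open>This majorant of the factors in \<open>S\<close> does not depend on t and
        can leave the time integral.\<close>
      define Q where "Q = (\<Prod>n\<in>S. K * V_norm s (v n) * sin x powr (\<theta> - 1))"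
      have Q: "Q \<ge> 0"
        unfolding Q_def using vS K by (intro prod_nonneg ballI mult_nonneg_nonneg V_norm_nonneg) auto
      have f: "\<bar>f t x\<bar> \<le> Q * (\<bar>V_fun (v a) t x\<bar> * \<bar>V_fun (v b) t x\<bar>)" for t
      proof -
        have "\<bar>f t x\<bar> = (\<Prod>n\<in>S. \<bar>V_fun (v n) t x\<bar>) * (\<bar>V_fun (v a) t x\<bar> * \<bar>V_fun (v b) t x\<bar>)"
          using S by (simp add: f_def abs_mult abs_prod)
        also have "\<dots> \<le> Q * (\<bar>V_fun (v a) t x\<bar> * \<bar>V_fun (v b) t x\<bar>)"
          unfolding Q_def K_def using vS \<theta> x by (intro mult_right_mono prod_mono) (auto intro!: abs_V_fun_le)
        finally show ?thesis .
      qed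
      have "(\<integral>\<^sup>+t\<in>{0..2 * pi}. ennreal \<bar>f t x\<bar> \<partial>lborel) \<le>
          (\<integral>\<^sup>+t. ennreal Q * (ennreal (\<bar>V_fun (v a) t x\<bar> * \<bar>V_fun (v b) t x\<bar>) * indicator {0..2 * pi} t) \<partial>lborel)"
        using f by (intro nn_integral_mono) (auto simp: indicator_def ennreal_mult'[OF Q, symmetric] intro!: ennreal_leI)
      also have "\<dots> = ennreal Q * (\<integral>\<^sup>+t\<in>{0..2 * pi}. ennreal (\<bar>V_fun (v a) t x\<bar> * \<bar>V_fun (v b) t x\<bar>) \<partial>lborel)"
        by (intro nn_integral_cmult) measurable
      also have "\<dots> \<le> ennreal Q * ennreal (pi * (V_norm \<sigma> (v a) * V_norm \<tau> (v b) * sin x powr (\<sigma> + \<tau> - 2)))"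
        by (intro mult_left_mono V_fun_bilinear_time va vb \<sigma> \<tau> x) auto
      also have "\<dots> = ennreal (Q * (pi * (V_norm \<sigma> (v a) * V_norm \<tau> (v b) * sin x powr (\<sigma> + \<tau> - 2))))"
        by (rule ennreal_mult'[OF Q, symmetric])
      also have "Q * (pi * (V_norm \<sigma> (v a) * V_norm \<tau> (v b) * sin x powr (\<sigma> + \<tau> - 2))) = c * sin x powr q"
      proof -
        have "(sin x powr (\<theta> - 1)) ^ card S = sin x powr (real (card S) * (\<theta> - 1))"
          using powr_realpow[of "sin x powr (\<theta> - 1)" "card S"] s
          by (simp add: powr_powr mult.commute)
        then show ?thesis
          by (simp add: Q_def c_def P_def q_def prod.distrib powr_add mult_ac)
      qed
      finally show ?thesis .
    qed
    have "\<bar>spacetime_integral f\<bar> \<le> c * J"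
      unfolding J_def by (rule spacetime_integral_bound(2)[OF meas c q bound])
    also have "\<dots> \<le> C * P"
      unfolding C_def c_def using K P by (simp add: algebra_simps)
    finally show ?thesis
      using spacetime_integral_bound(1)[OF meas c q bound] by (simp add: P_def)
  qed
  ultimately show ?thesis
    by blast
qed

section \<open>Truncation of the coefficients\<close>

text \<open>Finitely supported coefficients turn the integral of a product into a finite sum over
  mode interactions; general coefficients are recovered in the limit.\<close>

definition truncation :: "nat \<Rightarrow> (nat \<Rightarrow> real) \<Rightarrow> nat \<Rightarrow> real" where
  "truncation N v j = (if j < N then v j else 0)"

lemma truncation_V_space:
  assumes "v \<in> V_space s"
  shows "truncation N v \<in> V_space s" and "V_norm s (truncation N v) \<le> V_norm s v"
  using V_space_dominated[OF assms, of "truncation N v" s] by (auto simp: truncation_def)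

lemma V_fun_finite_support:
  assumes "\<And>j. j \<ge> N \<Longrightarrow> v j = 0"
  shows "V_fun v t x = (\<Sum>j<N. v j * cos (freq j * t) * eigf j x)"
  unfolding V_fun_def using assms by (intro suminf_finite) (auto simp: not_less)

lemma V_fun_truncation: "V_fun (truncation N v) t x = (\<Sum>j<N. v j * cos (freq j * t) * eigf j x)"
  by (subst V_fun_finite_support[where N = N]) (auto simp: truncation_def)

text \<open>Dominated convergence: the truncated functions are the partial sums of the series, and
  truncation does not increase norms, so one multiple of a power of sin x majorizes all the
  products. The exponent condition makes it integrable against sin^2 x.\<close>

lemma tendsto_spacetime_integral_truncation:
  assumes I: "finite I" and v: "\<And>n. n \<in> I \<Longrightarrow> v n \<in> V_space (s n)"
    and \<theta>: "\<And>n. n \<in> I \<Longrightarrow> 0 \<le> \<theta> n \<and> \<theta> n \<le> 1 \<and> \<theta> n < s n - 1 / 2"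
    and exponent: "(\<Sum>n\<in>I. \<theta> n - 1) > -3"
  shows "(\<lambda>N. spacetime_integral (\<lambda>t x. \<Prod>n\<in>I. V_fun (truncation N (v n)) t x))
    \<longlonglongrightarrow> spacetime_integral (\<lambda>t x. \<Prod>n\<in>I. V_fun (v n) t x)"
proof -
  define K where "K n = sobolev_const (s n - \<theta> n)" for n
  have K: "K n > 0" if "n \<in> I" for n
    unfolding K_def using \<theta>[OF that] by (intro sobolev_const_pos) auto
  define c where "c = (\<Prod>n\<in>I. K n * V_norm (s n) (v n))"
  have c: "c \<ge> 0"
    unfolding c_def using K v by (intro prod_nonneg ballI mult_nonneg_nonneg V_norm_nonneg) (auto intro: less_imp_le)
  define q where "q = (\<Sum>n\<in>I. \<theta> n - 1)"
  \<comment> \<open>Stated for any \<open>w\<close> with norms at most those of \<open>v\<close>, so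
    that it covers the truncations and \<open>v\<close> itself with the same constant.\<close>
  have bound: "\<bar>\<Prod>n\<in>I. V_fun (w n) t x\<bar> \<le> c * sin x powr q"
    if w: "\<And>n. n \<in> I \<Longrightarrow> w n \<in> V_space (s n) \<and> V_norm (s n) (w n) \<le> V_norm (s n) (v n)"
      and x: "0 < x" "x < pi" for w t x
  proof -
    have s: "sin x > 0"
      using x by (rule sin_gt_zero)
    have "\<bar>\<Prod>n\<in>I. V_fun (w n) t x\<bar> \<le> (\<Prod>n\<in>I. K n * V_norm (s n) (v n) * sin x powr (\<theta> n - 1))"
      unfolding abs_prod
    proof (intro prod_mono conjI)
      fix n assume n: "n \<in> I"
      have "\<bar>V_fun (w n) t x\<bar> \<le> K n * V_norm (s n) (w n) * sin x powr (\<theta> n - 1)"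
        unfolding K_def using w[OF n] \<theta>[OF n] x by (intro abs_V_fun_le) auto
      also have "\<dots> \<le> K n * V_norm (s n) (v n) * sin x powr (\<theta> n - 1)"
        using w[OF n] K[OF n] by (intro mult_right_mono mult_left_mono) auto
      finally show "\<bar>V_fun (w n) t x\<bar> \<le> K n * V_norm (s n) (v n) * sin x powr (\<theta> n - 1)" .
    qed auto
    also have "\<dots> = c * sin x powr q"
      using s by (simp add: prod.distrib c_def q_def powr_sum)
    finally show ?thesis .
  qed
  have int: "spacetime_integrable f"
    if f: "(\<lambda>(t, x). f t x) \<in> borel_measurable borel"
      "\<And>t x. 0 < x \<Longrightarrow> x < pi \<Longrightarrow> \<bar>f t x\<bar> \<le> c * sin x powr q" for f
  proof (rule spacetime_integral_bound(1)[OF f(1)])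
    fix x :: real assume x: "0 < x" "x < pi"
    have "(\<integral>\<^sup>+t\<in>{0..2 * pi}. ennreal \<bar>f t x\<bar> \<partial>lborel) \<le>
        (\<integral>\<^sup>+t. ennreal (c * sin x powr q) * indicator {0..2 * pi} t \<partial>lborel)"
      using f(2)[OF x] by (intro nn_integral_mono) (auto simp: indicator_def intro!: ennreal_leI)
    also have "\<dots> = ennreal (c * sin x powr q) * ennreal (2 * pi)"
      by (subst nn_integral_cmult_indicator) auto
    also have "\<dots> = ennreal (c * (2 * pi) * sin x powr q)"
      using c by (subst ennreal_mult[symmetric]) (auto simp: mult_ac)
    finally show "(\<integral>\<^sup>+t\<in>{0..2 * pi}. ennreal \<bar>f t x\<bar> \<partial>lborel) \<le> ennreal (c * (2 * pi) * sin x powr q)" .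
  qed (use c exponent in \<open>auto simp: q_def\<close>)
  define F where "F f z = indicat_real ({0..2 * pi} \<times> {0<..<pi}) z *
    (case z of (t, x) \<Rightarrow> f t x * (sin x)\<^sup>2 * (2 / pi) * (1 / pi))" for f :: "real \<Rightarrow> real \<Rightarrow> real" and z
  have F_int: "integrable lborel (F f)" if "spacetime_integrable f" for f
    using that by (simp add: spacetime_integrable_def set_integrable_def F_def[abs_def])
  have F_eq: "spacetime_integral f = integral\<^sup>L lborel (F f)" if "spacetime_integrable f" for f
    by (simp add: spacetime_integral_eq[OF that] set_lebesgue_integral_def F_def[abs_def])
  define f where "f N t x = (\<Prod>n\<in>I. V_fun (truncation N (v n)) t x)" for N t x
  define g where "g t x = (\<Prod>n\<in>I. V_fun (v n) t x)" for t x
  have f_le: "\<bar>f N t x\<bar> \<le> c * sin x powr q" if "0 < x" "x < pi" for N t x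
    unfolding f_def using v that by (intro bound) (auto intro: truncation_V_space)
  have f_int: "spacetime_integrable (f N)" for N
    by (rule int[OF _ f_le]) (auto simp: f_def borel_measurable_prod_V_fun)
  have g_int: "spacetime_integrable g"
    unfolding g_def using v by (intro int borel_measurable_prod_V_fun bound) auto
  have h_int: "spacetime_integrable (\<lambda>t x. c * sin x powr q)"
  proof (rule int)
    show "(\<lambda>(t::real, x). c * sin x powr q) \<in> borel_measurable borel"
      unfolding split_beta by measurable
    show "\<bar>c * sin x powr q\<bar> \<le> c * sin x powr q" for x
      using c by (simp add: abs_mult)
  qed
  have lim: "(\<lambda>N. f N t x) \<longlonglongrightarrow> g t x" if "0 < x" "x < pi" for t x
    unfolding f_def g_def
  proof (rule tendsto_prod)
    fix n assume n: "n \<in> I"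
    have "summable (\<lambda>j. v n j * cos (freq j * t) * eigf j x)"
      using \<theta>[OF n] by (intro summable_rabs_cancel[OF V_fun_abs_summable[OF v[OF n] _ that]]) auto
    then show "(\<lambda>N. V_fun (truncation N (v n)) t x) \<longlonglongrightarrow> V_fun (v n) t x"
      unfolding V_fun_truncation V_fun_def[of "v n"] by (rule summable_LIMSEQ)
  qed
  have "(\<lambda>N. integral\<^sup>L lborel (F (f N))) \<longlonglongrightarrow> integral\<^sup>L lborel (F g)"
  proof (rule integral_dominated_convergence)
    show "integrable lborel (F (\<lambda>t x. c * sin x powr q))"
      by (rule F_int[OF h_int])
    show "AE z in lborel. (\<lambda>N. F (f N) z) \<longlonglongrightarrow> F g z"
      using lim by (intro AE_I2) (auto simp: F_def indicator_def intro!: tendsto_intros)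
    show "AE z in lborel. norm (F (f N) z) \<le> F (\<lambda>t x. c * sin x powr q) z" for N
      using f_le[of _ N] by (intro AE_I2) (auto simp: F_def indicator_def abs_mult intro!: mult_right_mono divide_right_mono)
  qed (use F_int f_int g_int in auto)
  then show ?thesis
    using F_eq[OF f_int] F_eq[OF g_int] by (simp add: f_def[abs_def] g_def[abs_def])
qed

section \<open>Positivity and resonance of the interaction coefficients\<close>

text \<open>The additional integer frequency m makes the induction work: the product-to-sum formula
  absorbs one cosine by averaging the cases m - omega and m + omega. Averages preserve the sign, and
  each shift lowers |m| by at most omega, so an m beyond the sum of all frequencies never reaches
  0.\<close>

lemma integral_cos_product:
  assumes "finite S"
  defines "W \<equiv> \<lambda>m j S. LBINT t:{0..2 * pi}. cos (of_int m * t) * (\<Prod>n\<in>S. cos (freq (j n) * t))"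
  shows "W m j S \<ge> 0 \<and> (\<bar>of_int m\<bar> > (\<Sum>n\<in>S. freq (j n)) \<longrightarrow> W m j S = 0)"
  using assms(1)
proof (induction S arbitrary: m rule: finite_induct)
  case empty
  then show ?case
    by (auto simp: W_def integral_cos_int)
next
  case (insert a S)
  define p where "p = m + (int (j a) + 1)"
  define q where "q = m - (int (j a) + 1)"
  have "W m j (insert a S) = (LBINT t:{0..2 * pi}.
      (1 / 2) * (cos (of_int q * t) * (\<Prod>n\<in>S. cos (freq (j n) * t))) +
      (1 / 2) * (cos (of_int p * t) * (\<Prod>n\<in>S. cos (freq (j n) * t))))"
    unfolding W_def
  proof (intro set_lebesgue_integral_cong allI impI)
    fix t :: real
    have "cos (of_int m * t) * cos (freq (j a) * t) = (cos (of_int q * t) + cos (of_int p * t)) / 2"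
      by (simp add: cos_times_cos p_def q_def freq_def algebra_simps)
    moreover have "cos (of_int m * t) * (\<Prod>n\<in>insert a S. cos (freq (j n) * t)) =
        cos (of_int m * t) * cos (freq (j a) * t) * (\<Prod>n\<in>S. cos (freq (j n) * t))"
      using insert.hyps by simp
    ultimately show "cos (of_int m * t) * (\<Prod>n\<in>insert a S. cos (freq (j n) * t)) =
        (1 / 2) * (cos (of_int q * t) * (\<Prod>n\<in>S. cos (freq (j n) * t))) +
        (1 / 2) * (cos (of_int p * t) * (\<Prod>n\<in>S. cos (freq (j n) * t)))"
      by (simp only: add_divide_distrib distrib_right times_divide_eq_left mult_1 times_divide_eq_right)
  qed simp
  also have "\<dots> = (1 / 2) * W q j S + (1 / 2) * W p j S"
    unfolding W_def
    by (subst set_integral_add(2)) (auto intro!: set_integrable_continuous continuous_intros simp del: mult_1)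
  finally have eq: "W m j (insert a S) = (1 / 2) * W q j S + (1 / 2) * W p j S" .
  show ?case
  proof (intro conjI impI)
    show "W m j (insert a S) \<ge> 0"
      using insert.IH[of p] insert.IH[of q] by (simp add: eq)
    assume "\<bar>of_int m\<bar> > (\<Sum>n\<in>insert a S. freq (j n))"
    then have m: "\<bar>real_of_int m\<bar> > freq (j a) + (\<Sum>n\<in>S. freq (j n))"
      using insert.hyps by simp
    have "real_of_int p = of_int m + freq (j a)" "real_of_int q = of_int m - freq (j a)"
      by (simp_all add: p_def q_def freq_def)
    then have "\<bar>real_of_int p\<bar> > (\<Sum>n\<in>S. freq (j n))" "\<bar>real_of_int q\<bar> > (\<Sum>n\<in>S. freq (j n))"
      using m freq_pos[of "j a"] by linarith+
    then show "W m j (insert a S) = 0"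
      using insert.IH[of p] insert.IH[of q] by (simp add: eq)
  qed
qed

text \<open>The Clebsch-Gordan rule for the characters of \<open>SU(2)\<close>; it is a telescoping sum.\<close>

lemma eigf_mult_le:
  assumes "k \<le> j" and x: "0 < x" "x < pi"
  shows "eigf j x * eigf k x = (\<Sum>l<Suc k. eigf (j + k - 2 * l) x)"
proof -
  have s: "sin x > 0"
    using x by (rule sin_gt_zero)
  \<comment> \<open>Multiplied by sin x, each summand is a difference of consecutive values of
    \<open>g\<close>. The surviving end values have frequencies j - k and j + k + 2, the difference
    and the sum of omega_j and omega_k.\<close>
  define g where "g l = cos ((real j + real k + 2 - 2 * real l) * x) / 2" for l
  have "sin x * sin (freq (j + k - 2 * l) * x) = g (Suc l) - g l" if "l < Suc k" for l
  proof -
    \<comment> \<open>The natural subtraction is exact because l <= k <= j.\<close>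
    have "real (j + k - 2 * l) = real j + real k - 2 * real l"
      using that assms(1) by (subst of_nat_diff) auto
    then show ?thesis
      by (simp add: g_def freq_def sin_times_sin algebra_simps diff_divide_distrib)
        (simp add: cos_diff cos_add sin_diff sin_add algebra_simps)
  qed
  then have "sin x * (\<Sum>l<Suc k. sin (freq (j + k - 2 * l) * x)) = (\<Sum>l<Suc k. g (Suc l) - g l)"
    unfolding sum_distrib_left by (intro sum.cong) auto
  also have "\<dots> = g (Suc k) - g 0"
    by (rule sum_lessThan_telescope)
  also have "\<dots> = sin (freq j * x) * sin (freq k * x)"
    by (simp add: g_def freq_def sin_times_sin algebra_simps diff_divide_distrib)
  finally have "sin (freq j * x) * sin (freq k * x) = sin x * (\<Sum>l<Suc k. sin (freq (j + k - 2 * l) * x))" ..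
  then show ?thesis
    using s by (simp add: eigf_def sum_divide_distrib[symmetric] del: sum.lessThan_Suc)
qed

text \<open>Only the shape of the Clebsch-Gordan rule is kept, namely a finite sum of eigenfunctions
  with coefficients 1; this is what preserves positivity in the induction below.\<close>

lemma eigf_mult:
  "\<exists>A. finite A \<and> (\<forall>x. 0 < x \<and> x < pi \<longrightarrow> eigf j x * eigf k x = (\<Sum>l\<in>A. eigf (j + k - 2 * l) x))"
proof (cases "k \<le> j")
  case True
  then show ?thesis
    using eigf_mult_le[of k j] by (intro exI[of _ "{..<Suc k}"]) auto
next
  case False
  then show ?thesis
    using eigf_mult_le[of j k]
    by (intro exI[of _ "{..<Suc j}"]) (auto simp: mult.commute add.commute)
qed

lemma set_integrable_eigf_product:
  assumes "finite S"
  shows "set_integrable lborel {0<..<pi} (\<lambda>x. (\<Prod>n\<in>S. eigf (j n) x) * (sin x)\<^sup>2)"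
proof -
  have "set_integrable lborel {0<..<pi} (\<lambda>x. \<Prod>n\<in>S. freq (j n))"
    by (simp add: set_integrable_def)
  then show ?thesis
  proof (rule set_integrable_bound)
    show "set_borel_measurable lborel {0<..<pi} (\<lambda>x. (\<Prod>n\<in>S. eigf (j n) x) * (sin x)\<^sup>2)"
      by (simp add: set_borel_measurable_def eigf_def)
    have "\<bar>(\<Prod>n\<in>S. eigf (j n) x) * (sin x)\<^sup>2\<bar> \<le> (\<Prod>n\<in>S. freq (j n))" if x: "0 < x" "x < pi" for x
    proof -
      have "\<bar>eigf (j n) x\<bar> \<le> freq (j n)" for n
        using abs_eigf_le[OF x, of 1 "j n"] sin_gt_zero[OF x] by simp
      moreover have "(sin x)\<^sup>2 \<le> 1"
        by (simp add: abs_square_le_1)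
      ultimately have "(\<Prod>n\<in>S. \<bar>eigf (j n) x\<bar>) * (sin x)\<^sup>2 \<le> (\<Prod>n\<in>S. freq (j n)) * 1"
        by (intro mult_mono prod_mono prod_nonneg) auto
      then show ?thesis
        by (simp add: abs_mult abs_prod)
    qed
    then show "AE x in lborel. x \<in> {0<..<pi} \<longrightarrow>
        norm ((\<Prod>n\<in>S. eigf (j n) x) * (sin x)\<^sup>2) \<le> norm (\<Prod>n\<in>S. freq (j n))"
      using order_trans[OF _ abs_ge_self] by (intro AE_I2) auto
  qed
qed

text \<open>Since e_0 = 1, this is the inner product of e_m with e_0, up to normalization: pi / 2
  for m = 0 and 0 otherwise.\<close>

lemma integral_eigf_nonneg: "(LBINT x:{0<..<pi}. eigf m x * (sin x)\<^sup>2) \<ge> 0"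
proof -
  have null: "(LBINT x:{0<..<pi}. f x) = (LBINT x:{0..pi}. f x)" for f :: "real \<Rightarrow> real"
    using interval_integral_Icc[of 0 pi f] interval_integral_Ioo[of 0 pi f] by (simp add: zero_ereal_def)
  \<comment> \<open>An antiderivative of cos (c x) that includes c = 0, the only case in which the
    boundary values at pi do not vanish.\<close>
  define G where "G c x = (if c = 0 then x else sin (c * x) / c)" for c x :: real
  have G: "(G c has_real_derivative cos (c * x)) (at x within T)" for c x T
    unfolding G_def by (cases "c = 0") (auto intro!: derivative_eq_intros)
  define F where "F x = G (real m) x / 2 - G (real m + 2) x / 2" for x
  have "(LBINT x:{0<..<pi}. eigf m x * (sin x)\<^sup>2) =
      (LBINT x:{0<..<pi}. cos (real m * x) / 2 - cos ((real m + 2) * x) / 2)"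
  proof (intro set_lebesgue_integral_cong allI impI)
    fix x :: real assume "x \<in> {0<..<pi}"
    then have "sin x > 0"
      by (auto intro: sin_gt_zero)
    then have "eigf m x * (sin x)\<^sup>2 = sin (freq m * x) * sin x"
      by (simp add: eigf_def power2_eq_square)
    also have "\<dots> = cos (real m * x) / 2 - cos ((real m + 2) * x) / 2"
      by (simp add: sin_times_sin freq_def algebra_simps diff_divide_distrib)
    finally show "eigf m x * (sin x)\<^sup>2 = cos (real m * x) / 2 - cos ((real m + 2) * x) / 2" .
  qed simp
  also have "\<dots> = (LBINT x. indicator {0..pi} x *\<^sub>R (cos (real m * x) / 2 - cos ((real m + 2) * x) / 2))"
    unfolding null by (simp add: set_lebesgue_integral_def)
  also have "\<dots> = F pi - F 0"
  proof (rule integral_FTC_Icc)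
    show "(F has_vector_derivative cos (real m * x) / 2 - cos ((real m + 2) * x) / 2) (at x within {0..pi})" for x
      unfolding F_def has_real_derivative_iff_has_vector_derivative[symmetric]
      by (intro DERIV_diff DERIV_cdivide G)
  qed (auto intro!: continuous_intros)
  also have "\<dots> = (if m = 0 then pi / 2 else 0)"
    using sin_npi[of m] sin_npi[of "m + 2"] by (auto simp: F_def G_def add.commute[of _ 2])
  finally show ?thesis
    by simp
qed

text \<open>The leading factor e_m carries the induction: \<open>eigf_mult\<close> merges it with
  the next factor into a sum of eigenfunctions, each of which is the leading factor of a shorter
  product.\<close>

lemma integral_eigf_product_nonneg:
  assumes "finite S"
  shows "(LBINT x:{0<..<pi}. eigf m x * (\<Prod>n\<in>S. eigf (j n) x) * (sin x)\<^sup>2) \<ge> 0"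
  using assms
proof (induction S arbitrary: m rule: finite_induct)
  case empty
  then show ?case
    using integral_eigf_nonneg by simp
next
  case (insert a S)
  define d where "d l = m + j a - 2 * l" for l
  obtain A where A: "finite A" "\<And>x. 0 < x \<Longrightarrow> x < pi \<Longrightarrow> eigf m x * eigf (j a) x = (\<Sum>l\<in>A. eigf (d l) x)"
    using eigf_mult[of m "j a"] unfolding d_def by blast
  have int: "set_integrable lborel {0<..<pi} (\<lambda>x. eigf k x * (\<Prod>n\<in>S. eigf (j n) x) * (sin x)\<^sup>2)" for k
  proof -
    \<comment> \<open>The free index \<open>a\<close> holds the leading mode, so integrability of
      plain products applies.\<close>
    have eq: "(\<Prod>n\<in>insert a S. eigf ((j(a := k)) n) x) = eigf k x * (\<Prod>n\<in>S. eigf (j n) x)" for x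
      using insert.hyps by (auto intro!: prod.cong)
    show ?thesis
      using set_integrable_eigf_product[of "insert a S" "j(a := k)"] insert.hyps(1)
      unfolding eq by blast
  qed
  have "(LBINT x:{0<..<pi}. eigf m x * (\<Prod>n\<in>insert a S. eigf (j n) x) * (sin x)\<^sup>2) =
      (LBINT x:{0<..<pi}. (\<Sum>l\<in>A. eigf (d l) x * (\<Prod>n\<in>S. eigf (j n) x) * (sin x)\<^sup>2))"
  proof (intro set_lebesgue_integral_cong allI impI)
    fix x :: real assume "x \<in> {0<..<pi}"
    then show "eigf m x * (\<Prod>n\<in>insert a S. eigf (j n) x) * (sin x)\<^sup>2 =
        (\<Sum>l\<in>A. eigf (d l) x * (\<Prod>n\<in>S. eigf (j n) x) * (sin x)\<^sup>2)"
      using insert.hyps A(2)[of x] by (simp add: sum_distrib_right[symmetric] mult.assoc[symmetric])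
  qed simp
  also have "\<dots> = (\<Sum>l\<in>A. LBINT x:{0<..<pi}. eigf (d l) x * (\<Prod>n\<in>S. eigf (j n) x) * (sin x)\<^sup>2)"
    by (rule set_lebesgue_integral_sum[OF int])
  also have "\<dots> \<ge> 0"
    by (intro sum_nonneg insert.IH)
  finally show ?case .
qed

text \<open>The normalized space-time integral of a product of single modes, already split into its
  time and space factors.\<close>

definition interaction :: "'i set \<Rightarrow> ('i \<Rightarrow> nat) \<Rightarrow> real" where
  "interaction I j =
    (LBINT t:{0..2 * pi}. \<Prod>n\<in>I. cos (freq (j n) * t)) *
    (LBINT x:{0<..<pi}. (\<Prod>n\<in>I. eigf (j n) x) * (sin x)\<^sup>2) * (2 / pi) * (1 / pi)"

lemma interaction_nonneg:
  assumes "finite I"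
  shows "interaction I j \<ge> 0"
proof -
  \<comment> \<open>The positivity lemmas carry one additional mode; it is made trivial by e_0 = 1
    in space and by m = 0 in time.\<close>
  have "eigf 0 x = 1" if "x \<in> {0<..<pi}" for x
    using that sin_gt_zero[of x] by (simp add: eigf_def freq_def)
  then have "(LBINT x:{0<..<pi}. eigf 0 x * (\<Prod>n\<in>I. eigf (j n) x) * (sin x)\<^sup>2) =
      (LBINT x:{0<..<pi}. (\<Prod>n\<in>I. eigf (j n) x) * (sin x)\<^sup>2)"
    by (intro set_lebesgue_integral_cong) auto
  then have "(LBINT x:{0<..<pi}. (\<Prod>n\<in>I. eigf (j n) x) * (sin x)\<^sup>2) \<ge> 0"
    using integral_eigf_product_nonneg[OF assms, of 0 j] by simp
  moreover have "(LBINT t:{0..2 * pi}. \<Prod>n\<in>I. cos (freq (j n) * t)) \<ge> 0"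
    using integral_cos_product[OF assms, of 0 j] by simp
  ultimately show ?thesis
    unfolding interaction_def by (intro mult_nonneg_nonneg) auto
qed

text \<open>The time integral vanishes when one frequency exceeds the sum of the others; the
  frequency at \<open>a\<close> takes the role of m in \<open>integral_cos_product\<close>.\<close>

lemma interaction_resonance:
  assumes "finite S" "a \<notin> S" and "interaction (insert a S) j \<noteq> 0"
  shows "freq (j a) \<le> (\<Sum>n\<in>S. freq (j n))"
proof (rule ccontr)
  assume "\<not> ?thesis"
  then have "\<bar>real_of_int (int (j a) + 1)\<bar> > (\<Sum>n\<in>S. freq (j n))"
    by (simp add: freq_def)
  then have "(LBINT t:{0..2 * pi}. \<Prod>n\<in>insert a S. cos (freq (j n) * t)) = 0"
    using integral_cos_product[OF assms(1), of "int (j a) + 1" j] assms by (simp add: freq_def)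
  then show False
    using assms(3) by (simp add: interaction_def)
qed

text \<open>Multiplying out the finite sums gives one term for each choice \<open>g\<close> of a
  mode in every factor; linearity of both integrals then separates t and x.\<close>

lemma spacetime_integral_expansion:
  assumes I: "finite I" and v: "\<And>n j. n \<in> I \<Longrightarrow> j \<ge> N \<Longrightarrow> v n j = 0"
  shows "spacetime_integral (\<lambda>t x. \<Prod>n\<in>I. V_fun (v n) t x) =
    (\<Sum>g\<in>I \<rightarrow>\<^sub>E {..<N}. (\<Prod>n\<in>I. v n (g n)) * interaction I g)"
proof -
  define c where "c g = (\<Prod>n\<in>I. v n (g n))" for g
  define T where "T g t = (\<Prod>n\<in>I. cos (freq (g n) * t))" for g t
  define E where "E g x = (\<Prod>n\<in>I. eigf (g n) x) * (sin x)\<^sup>2" for g x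
  have expand: "(\<Prod>n\<in>I. V_fun (v n) t x) * (sin x)\<^sup>2 * (2 / pi) =
      (\<Sum>g\<in>I \<rightarrow>\<^sub>E {..<N}. c g * T g t * (2 / pi) * E g x)" for t x
  proof -
    have "(\<Prod>n\<in>I. V_fun (v n) t x) = (\<Prod>n\<in>I. \<Sum>j<N. v n j * cos (freq j * t) * eigf j x)"
      using v by (intro prod.cong refl V_fun_finite_support)
    also have "\<dots> = (\<Sum>g\<in>I \<rightarrow>\<^sub>E {..<N}. \<Prod>n\<in>I. v n (g n) * cos (freq (g n) * t) * eigf (g n) x)"
      by (intro prod_sum_PiE I) auto
    finally have "(\<Prod>n\<in>I. V_fun (v n) t x) =
        (\<Sum>g\<in>I \<rightarrow>\<^sub>E {..<N}. \<Prod>n\<in>I. v n (g n) * cos (freq (g n) * t) * eigf (g n) x)" .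
    then have "(\<Prod>n\<in>I. V_fun (v n) t x) * (sin x)\<^sup>2 * (2 / pi) =
        (\<Sum>g\<in>I \<rightarrow>\<^sub>E {..<N}. (\<Prod>n\<in>I. v n (g n) * cos (freq (g n) * t) * eigf (g n) x) * (sin x)\<^sup>2 * (2 / pi))"
      by (simp only: sum_distrib_right)
    also have "\<dots> = (\<Sum>g\<in>I \<rightarrow>\<^sub>E {..<N}. c g * T g t * (2 / pi) * E g x)"
      by (intro sum.cong refl) (simp add: c_def T_def E_def prod.distrib)
    finally show ?thesis .
  qed
  have inner: "(LBINT x:{0<..<pi}. (\<Prod>n\<in>I. V_fun (v n) t x) * (sin x)\<^sup>2 * (2 / pi)) * (1 / pi) =
      (\<Sum>g\<in>I \<rightarrow>\<^sub>E {..<N}. c g * (2 / pi) * (1 / pi) * (LBINT x:{0<..<pi}. E g x) * T g t)" for t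
  proof -
    have "(LBINT x:{0<..<pi}. (\<Prod>n\<in>I. V_fun (v n) t x) * (sin x)\<^sup>2 * (2 / pi)) =
        (\<Sum>g\<in>I \<rightarrow>\<^sub>E {..<N}. LBINT x:{0<..<pi}. c g * T g t * (2 / pi) * E g x)"
      unfolding expand
      by (intro set_lebesgue_integral_sum set_integrable_mult_right) (simp add: E_def set_integrable_eigf_product I)
    also have "\<dots> = (\<Sum>g\<in>I \<rightarrow>\<^sub>E {..<N}. c g * T g t * (2 / pi) * (LBINT x:{0<..<pi}. E g x))"
      by simp
    finally show ?thesis
      by (simp add: sum_distrib_right sum_divide_distrib mult_ac)
  qed
  have "spacetime_integral (\<lambda>t x. \<Prod>n\<in>I. V_fun (v n) t x) = (\<Sum>g\<in>I \<rightarrow>\<^sub>E {..<N}.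
      LBINT t:{0..2 * pi}. c g * (2 / pi) * (1 / pi) * (LBINT x:{0<..<pi}. E g x) * T g t)"
    unfolding spacetime_integral_def inner T_def
    by (intro set_lebesgue_integral_sum set_integrable_continuous continuous_intros)
  also have "\<dots> = (\<Sum>g\<in>I \<rightarrow>\<^sub>E {..<N}. c g * interaction I g)"
    by (intro sum.cong refl) (simp add: interaction_def T_def E_def)
  finally show ?thesis
    by (simp add: c_def)
qed

section \<open>Transfer of derivatives\<close>

text \<open>Nonnegative interactions allow absolute values on the coefficients. At resonance the
  frequency at \<open>a\<close> is at most card S times the largest one, at \<open>k\<close> say, so
  a factor (card S)^\<delta> (omega_k / omega_a)^\<delta> >= 1 may be inserted. The result is again
  an expansion, now of the functions with coefficients \<open>w k\<close>.\<close>

lemma spacetime_integral_resonant_bound: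
  assumes S: "finite S" "a \<notin> S" and \<delta>: "\<delta> \<ge> 0"
    and v: "\<And>n j. n \<in> insert a S \<Longrightarrow> j \<ge> N \<Longrightarrow> v n j = 0"
  defines "w \<equiv> \<lambda>k n j. \<bar>v n j\<bar> * freq j powr (if n = k then \<delta> else if n = a then - \<delta> else 0)"
  shows "\<bar>spacetime_integral (\<lambda>t x. \<Prod>n\<in>insert a S. V_fun (v n) t x)\<bar> \<le>
    real (card S) powr \<delta> * (\<Sum>k\<in>S. spacetime_integral (\<lambda>t x. \<Prod>n\<in>insert a S. V_fun (w k n) t x))"
proof -
  let ?I = "insert a S"
  let ?G = "?I \<rightarrow>\<^sub>E {..<N}"
  let ?M = "real (card S) powr \<delta>"
  have I: "finite ?I"
    using S by simp
  have w: "\<And>n j. n \<in> ?I \<Longrightarrow> j \<ge> N \<Longrightarrow> w k n j = 0" for k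
    using v by (simp add: w_def)
  have w_expansion: "spacetime_integral (\<lambda>t x. \<Prod>n\<in>?I. V_fun (w k n) t x) =
      (\<Sum>g\<in>?G. (\<Prod>n\<in>?I. w k n (g n)) * interaction ?I g)" for k
    by (rule spacetime_integral_expansion[where v = "w k", OF I w])
  have w_nonneg: "w k n j \<ge> 0" for k n j
    by (simp add: w_def)
  have w_prod: "(\<Prod>n\<in>?I. w k n (g n)) =
      (\<Prod>n\<in>?I. \<bar>v n (g n)\<bar>) * (freq (g k) powr \<delta> * freq (g a) powr - \<delta>)" if "k \<in> S" for k g
  proof -
    have "(\<Prod>n\<in>S. freq (g n) powr (if n = k then \<delta> else if n = a then - \<delta> else 0)) =
        (\<Prod>n\<in>S. if n = k then freq (g n) powr \<delta> else 1)"
      using S by (intro prod.cong) auto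
    also have "\<dots> = freq (g k) powr \<delta>"
      using S that by (simp add: prod.delta)
    finally have "(\<Prod>n\<in>?I. freq (g n) powr (if n = k then \<delta> else if n = a then - \<delta> else 0)) =
        freq (g k) powr \<delta> * freq (g a) powr - \<delta>"
      using S that by (subst prod.insert) (auto simp: mult.commute)
    then show ?thesis
      by (simp only: w_def prod.distrib)
  qed
  have "\<bar>\<Prod>n\<in>?I. v n (g n)\<bar> * interaction ?I g \<le>
      (\<Sum>k\<in>S. ?M * ((\<Prod>n\<in>?I. w k n (g n)) * interaction ?I g))" for g
  proof (cases "interaction ?I g = 0")
    case False
    then have res: "freq (g a) \<le> (\<Sum>n\<in>S. freq (g n))"
      by (rule interaction_resonance[OF S])
    have "S \<noteq> {}"
      \<comment> \<open>Frequencies are positive, so an empty sum cannot resonate.\<close>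
      using res freq_pos[of "g a"] by (metis not_less sum.empty)
    then have "Max ((\<lambda>n. freq (g n)) ` S) \<in> (\<lambda>n. freq (g n)) ` S"
      using S(1) by (intro Max_in) auto
    then obtain k where k: "k \<in> S" and max: "Max ((\<lambda>n. freq (g n)) ` S) = freq (g k)"
      by blast
    have le: "freq (g n) \<le> freq (g k)" if "n \<in> S" for n
      unfolding max[symmetric] using S(1) that by (intro Max_ge) auto
    have "freq (g a) \<le> real (card S) * freq (g k)"
      using res sum_bounded_above[of S "\<lambda>n. freq (g n)" "freq (g k)"] le by auto
    then have "freq (g a) powr \<delta> \<le> (real (card S) * freq (g k)) powr \<delta>"
      using \<delta> by (intro powr_mono2) auto
    then have "1 \<le> ?M * (freq (g k) powr \<delta> * freq (g a) powr - \<delta>)"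
      by (simp add: powr_mult powr_minus field_simps)
    then have "(\<Prod>n\<in>?I. \<bar>v n (g n)\<bar>) * 1 \<le> (\<Prod>n\<in>?I. \<bar>v n (g n)\<bar>) * (?M * (freq (g k) powr \<delta> * freq (g a) powr - \<delta>))"
      by (intro mult_left_mono prod_nonneg) auto
    then have "\<bar>\<Prod>n\<in>?I. v n (g n)\<bar> \<le> ?M * (\<Prod>n\<in>?I. w k n (g n))"
      unfolding w_prod[OF k] by (simp add: abs_prod mult_ac)
    then have "\<bar>\<Prod>n\<in>?I. v n (g n)\<bar> * interaction ?I g \<le> ?M * (\<Prod>n\<in>?I. w k n (g n)) * interaction ?I g"
      by (intro mult_right_mono interaction_nonneg I)
    also have "\<dots> = ?M * ((\<Prod>n\<in>?I. w k n (g n)) * interaction ?I g)"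
      by simp
    \<comment> \<open>The maximizing \<open>k\<close> depends on \<open>g\<close>; adding the other
      nonnegative terms removes this dependence.\<close>
    also have "\<dots> \<le> (\<Sum>k\<in>S. ?M * ((\<Prod>n\<in>?I. w k n (g n)) * interaction ?I g))"
      using k S(1)
      by (intro member_le_sum mult_nonneg_nonneg prod_nonneg ballI w_nonneg interaction_nonneg I) auto
    finally show ?thesis .
  qed simp
  then have "(\<Sum>g\<in>?G. \<bar>\<Prod>n\<in>?I. v n (g n)\<bar> * interaction ?I g) \<le>
      (\<Sum>g\<in>?G. \<Sum>k\<in>S. ?M * ((\<Prod>n\<in>?I. w k n (g n)) * interaction ?I g))"
    by (intro sum_mono)
  also have "\<dots> = ?M * (\<Sum>k\<in>S. spacetime_integral (\<lambda>t x. \<Prod>n\<in>?I. V_fun (w k n) t x))"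
    unfolding w_expansion sum_distrib_left by (rule sum.swap)
  finally have "(\<Sum>g\<in>?G. \<bar>\<Prod>n\<in>?I. v n (g n)\<bar> * interaction ?I g) \<le>
      ?M * (\<Sum>k\<in>S. spacetime_integral (\<lambda>t x. \<Prod>n\<in>?I. V_fun (w k n) t x))" .
  moreover have "\<bar>\<Sum>g\<in>?G. (\<Prod>n\<in>?I. v n (g n)) * interaction ?I g\<bar> \<le>
      (\<Sum>g\<in>?G. \<bar>\<Prod>n\<in>?I. v n (g n)\<bar> * interaction ?I g)"
    using interaction_nonneg[OF I] by (intro order_trans[OF sum_abs]) (simp add: abs_mult)
  ultimately show ?thesis
    using spacetime_integral_expansion[where v = v, OF I v] by simp
qed

text \<open>After the transfer, the factor at \<open>k\<close> has order 1, the one at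
  \<open>a\<close> order 0, and both go into L^2 in time. The other card S - 1 factors keep order 1
  + \<delta> and are bounded uniformly. The constant is chosen before the cutoff \<open>N\<close>,
  which permits a limit later.\<close>

lemma spacetime_negative_order_estimate_finite:
  assumes S: "finite S" "a \<notin> S" and \<delta>: "\<delta> \<ge> 0"
    and \<theta>: "0 \<le> \<theta>" "\<theta> \<le> 1" "\<theta> < 1 / 2 + \<delta>"
    and exponent: "(real (card S) - 1) * (\<theta> - 1) > -2"
  shows "\<exists>C>0. \<forall>v N. (\<forall>n\<in>S. v n \<in> V_space (1 + \<delta>)) \<and> v a \<in> V_space (- \<delta>) \<and>
      (\<forall>n\<in>insert a S. \<forall>j\<ge>N. v n j = 0) \<longrightarrow>
      \<bar>spacetime_integral (\<lambda>t x. \<Prod>n\<in>insert a S. V_fun (v n) t x)\<bar>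
        \<le> C * ((\<Prod>n\<in>S. V_norm (1 + \<delta>) (v n)) * V_norm (- \<delta>) (v a))"
proof -
  have "\<exists>C>0. \<forall>v. (\<forall>n\<in>S - {k}. v n \<in> V_space (1 + \<delta>)) \<and>
      v k \<in> V_space 1 \<and> summable (\<lambda>j. \<bar>v k j\<bar>) \<and> v a \<in> V_space 0 \<and> summable (\<lambda>j. \<bar>v a j\<bar>) \<longrightarrow>
      spacetime_integrable (\<lambda>t x. \<Prod>n\<in>insert k (insert a (S - {k})). V_fun (v n) t x) \<and>
      \<bar>spacetime_integral (\<lambda>t x. \<Prod>n\<in>insert k (insert a (S - {k})). V_fun (v n) t x)\<bar>
        \<le> C * ((\<Prod>n\<in>S - {k}. V_norm (1 + \<delta>) (v n)) * V_norm 1 (v k) * V_norm 0 (v a))"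
    if k: "k \<in> S" for k
  proof (rule spacetime_multilinear_estimate[where \<theta> = \<theta>])
    have "real (card (S - {k})) = real (card S) - 1"
      using k S(1) card_gt_0_iff[of S] by (subst card_Diff_singleton) (auto simp: of_nat_diff Suc_leI)
    then show "real (card (S - {k})) * (\<theta> - 1) + 1 + 0 > -1"
      using exponent by simp
  qed (use S k \<theta> in auto)
  then obtain C where C: "\<And>k. k \<in> S \<Longrightarrow> C k > 0" and est: "\<And>k v. k \<in> S \<Longrightarrow>
      \<forall>n\<in>S - {k}. v n \<in> V_space (1 + \<delta>) \<Longrightarrow>
      v k \<in> V_space 1 \<Longrightarrow> summable (\<lambda>j. \<bar>v k j\<bar>) \<Longrightarrow> v a \<in> V_space 0 \<Longrightarrow> summable (\<lambda>j. \<bar>v a j\<bar>) \<Longrightarrow>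
      \<bar>spacetime_integral (\<lambda>t x. \<Prod>n\<in>insert k (insert a (S - {k})). V_fun (v n) t x)\<bar>
        \<le> C k * ((\<Prod>n\<in>S - {k}. V_norm (1 + \<delta>) (v n)) * V_norm 1 (v k) * V_norm 0 (v a))"
    by metis
  \<comment> \<open>The summand 1 keeps the constant positive even for empty
    \<open>S\<close>.\<close>
  define D where "D = real (card S) powr \<delta> * (\<Sum>k\<in>S. C k) + 1"
  have "real (card S) powr \<delta> * (\<Sum>k\<in>S. C k) \<ge> 0"
    using C by (intro mult_nonneg_nonneg sum_nonneg) (auto intro: less_imp_le)
  then have "D > 0"
    by (simp add: D_def)
  moreover have "\<bar>spacetime_integral (\<lambda>t x. \<Prod>n\<in>insert a S. V_fun (v n) t x)\<bar>
        \<le> D * ((\<Prod>n\<in>S. V_norm (1 + \<delta>) (v n)) * V_norm (- \<delta>) (v a))"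
    if vS: "\<forall>n\<in>S. v n \<in> V_space (1 + \<delta>)" and va: "v a \<in> V_space (- \<delta>)"
      and supp: "\<forall>n\<in>insert a S. \<forall>j\<ge>N. v n j = 0" for v N
  proof -
    define w where "w k n j = \<bar>v n j\<bar> * freq j powr (if n = k then \<delta> else if n = a then - \<delta> else 0)" for k n j
    define P where "P = (\<Prod>n\<in>S. V_norm (1 + \<delta>) (v n)) * V_norm (- \<delta>) (v a)"
    have P: "P \<ge> 0"
      unfolding P_def using vS va by (intro mult_nonneg_nonneg prod_nonneg ballI V_norm_nonneg) auto
    have term_le: "spacetime_integral (\<lambda>t x. \<Prod>n\<in>insert a S. V_fun (w k n) t x) \<le> C k * P" if k: "k \<in> S" for k
    proof -
      have ka: "k \<noteq> a"
        using k S by auto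
      \<comment> \<open>Finite support supplies the absolute summability that order 0 alone would
        not give.\<close>
      have sm: "summable (\<lambda>j. \<bar>w k n j\<bar>)" if "n \<in> insert a S" for n
        using supp that by (intro summable_finite[of "{..<N}"]) (auto simp: w_def not_less)
      have 1: "w k n \<in> V_space (1 + \<delta>)" "V_norm (1 + \<delta>) (w k n) \<le> V_norm (1 + \<delta>) (v n)" if "n \<in> S - {k}" for n
      proof -
        have "n \<noteq> k" "n \<noteq> a" "v n \<in> V_space (1 + \<delta>)"
          using that S vS by auto
        then show "w k n \<in> V_space (1 + \<delta>)" "V_norm (1 + \<delta>) (w k n) \<le> V_norm (1 + \<delta>) (v n)"
          using V_space_dominated[of "v n" "1 + \<delta>" "w k n" "1 + \<delta>"] by (simp_all add: w_def)
      qed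
      have 2: "w k k \<in> V_space 1" "V_norm 1 (w k k) \<le> V_norm (1 + \<delta>) (v k)"
        using V_space_dominated[of "v k" "1 + \<delta>" "w k k" 1] vS k
        by (auto simp: w_def powr_add abs_mult)
      have 3: "w k a \<in> V_space 0" "V_norm 0 (w k a) \<le> V_norm (- \<delta>) (v a)"
        using V_space_dominated[of "v a" "- \<delta>" "w k a" 0] va ka by (auto simp: w_def abs_mult)
      have I: "insert k (insert a (S - {k})) = insert a S"
        using k by auto
      have "\<bar>spacetime_integral (\<lambda>t x. \<Prod>n\<in>insert a S. V_fun (w k n) t x)\<bar> \<le>
          C k * ((\<Prod>n\<in>S - {k}. V_norm (1 + \<delta>) (w k n)) * V_norm 1 (w k k) * V_norm 0 (w k a))"
        using est[OF k, of "w k"] 1(1) 2(1) 3(1) sm k unfolding I by blast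
      also have "\<dots> \<le> C k * ((\<Prod>n\<in>S - {k}. V_norm (1 + \<delta>) (v n)) * V_norm (1 + \<delta>) (v k) * V_norm (- \<delta>) (v a))"
        using 1 2 3 vS va k less_imp_le[OF C[OF k]]
        by (intro mult_left_mono mult_mono prod_mono conjI mult_nonneg_nonneg prod_nonneg ballI V_norm_nonneg) auto
      also have "\<dots> = C k * P"
        using k S(1) by (simp add: P_def prod.remove[of S k] mult_ac)
      finally show ?thesis
        by simp
    qed
    have "\<bar>spacetime_integral (\<lambda>t x. \<Prod>n\<in>insert a S. V_fun (v n) t x)\<bar> \<le>
        real (card S) powr \<delta> * (\<Sum>k\<in>S. spacetime_integral (\<lambda>t x. \<Prod>n\<in>insert a S. V_fun (w k n) t x))"
      unfolding w_def using supp by (intro spacetime_integral_resonant_bound[where N = N] S \<delta>) auto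
    also have "\<dots> \<le> real (card S) powr \<delta> * (\<Sum>k\<in>S. C k * P)"
      by (intro mult_left_mono sum_mono term_le) auto
    also have "\<dots> = real (card S) powr \<delta> * (\<Sum>k\<in>S. C k) * P"
      by (simp add: sum_distrib_right mult.assoc)
    also have "\<dots> \<le> D * P"
      using P by (simp add: D_def distrib_right)
    finally show ?thesis
      unfolding P_def .
  qed
  ultimately show ?thesis
    by blast
qed

section \<open>The two six-linear estimates\<close>

theorem proposition4p5:
  shows "(\<forall>\<delta>>0. \<exists>C>0. \<forall>v :: nat \<Rightarrow> nat \<Rightarrow> real.
           (\<forall>n\<in>{1..6}. v n \<in> V_space (5 / 6 + \<delta>)) \<longrightarrow>
             spacetime_integrable (\<lambda>t x. \<Prod>n=1..6. V_fun (v n) t x) \<and>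
             \<bar>spacetime_integral (\<lambda>t x. \<Prod>n=1..6. V_fun (v n) t x)\<bar>
               \<le> C * (\<Prod>n=1..6. V_norm (5 / 6 + \<delta>) (v n)))
       \<and> (\<forall>\<delta>>0. \<exists>C>0. \<forall>v :: nat \<Rightarrow> nat \<Rightarrow> real.
           (\<forall>n\<in>{1..5}. v n \<in> V_space (1 + \<delta>)) \<and> v 6 \<in> V_space 1 \<longrightarrow>
             spacetime_integrable (\<lambda>t x. \<Prod>n=1..6. V_fun (v n) t x) \<and>
             \<bar>spacetime_integral (\<lambda>t x. \<Prod>n=1..6. V_fun (v n) t x)\<bar>
               \<le> C * (\<Prod>n=1..5. V_norm (1 + \<delta>) (v n)) * V_norm (- \<delta>) (v 6))"
proof (intro conjI allI impI)
  fix \<delta> :: real assume \<delta>: "\<delta> > 0"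
  \<comment> \<open>Four uniform factors and two L^2 factors of order 5/6 require 4 (\<theta> - 1) +
    5/3 > -1, that is \<theta> > 1/3, while the sup bound requires \<theta> < 1/3 +
    \<delta>.\<close>
  define \<theta> where "\<theta> = min (1 / 3 + \<delta> / 2) 1"
  have \<theta>: "1 / 3 < \<theta>" "\<theta> \<le> 1" "\<theta> < 5 / 6 + \<delta> - 1 / 2"
    using \<delta> by (auto simp: \<theta>_def min_def)
  have I: "insert 5 (insert 6 {1..4}) = {1..6::nat}"
    by auto
  obtain C where C: "C > 0" and est: "\<And>v. (\<forall>n\<in>{1..4::nat}. v n \<in> V_space (5 / 6 + \<delta>)) \<and>
      v 5 \<in> V_space (5 / 6) \<and> summable (\<lambda>j. \<bar>v 5 j\<bar>) \<and> v 6 \<in> V_space (5 / 6) \<and> summable (\<lambda>j. \<bar>v 6 j\<bar>) \<Longrightarrow>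
      spacetime_integrable (\<lambda>t x. \<Prod>n=1..6. V_fun (v n) t x) \<and>
      \<bar>spacetime_integral (\<lambda>t x. \<Prod>n=1..6. V_fun (v n) t x)\<bar>
        \<le> C * ((\<Prod>n=1..4. V_norm (5 / 6 + \<delta>) (v n)) * V_norm (5 / 6) (v 5) * V_norm (5 / 6) (v 6))"
    using spacetime_multilinear_estimate[of "{1..4::nat}" 5 6 \<theta> "5 / 6 + \<delta>" "5 / 6" "5 / 6"] \<theta>
    unfolding I by auto
  show "\<exists>C>0. \<forall>v :: nat \<Rightarrow> nat \<Rightarrow> real.
           (\<forall>n\<in>{1..6}. v n \<in> V_space (5 / 6 + \<delta>)) \<longrightarrow>
             spacetime_integrable (\<lambda>t x. \<Prod>n=1..6. V_fun (v n) t x) \<and>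
             \<bar>spacetime_integral (\<lambda>t x. \<Prod>n=1..6. V_fun (v n) t x)\<bar>
               \<le> C * (\<Prod>n=1..6. V_norm (5 / 6 + \<delta>) (v n))"
  proof (intro exI[of _ C] conjI C allI impI)
    fix v :: "nat \<Rightarrow> nat \<Rightarrow> real"
    assume v: "\<forall>n\<in>{1..6}. v n \<in> V_space (5 / 6 + \<delta>)"
    have lower: "v n \<in> V_space (5 / 6)" "V_norm (5 / 6) (v n) \<le> V_norm (5 / 6 + \<delta>) (v n)" "summable (\<lambda>j. \<bar>v n j\<bar>)"
      if "n \<in> {1..6}" for n
    proof -
      have "v n \<in> V_space (5 / 6 + \<delta>)"
        using v that by blast
      then show "v n \<in> V_space (5 / 6)" "V_norm (5 / 6) (v n) \<le> V_norm (5 / 6 + \<delta>) (v n)" "summable (\<lambda>j. \<bar>v n j\<bar>)"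
        using V_norm_mono[of "v n" "5 / 6 + \<delta>" "5 / 6"] V_space_summable_abs[of "v n" "5 / 6 + \<delta>"] \<delta> by auto
    qed
    have bound: "spacetime_integrable (\<lambda>t x. \<Prod>n=1..6. V_fun (v n) t x) \<and>
      \<bar>spacetime_integral (\<lambda>t x. \<Prod>n=1..6. V_fun (v n) t x)\<bar>
        \<le> C * ((\<Prod>n=1..4. V_norm (5 / 6 + \<delta>) (v n)) * V_norm (5 / 6) (v 5) * V_norm (5 / 6) (v 6))"
      using v lower by (intro est) auto
    then show "spacetime_integrable (\<lambda>t x. \<Prod>n=1..6. V_fun (v n) t x)" ..
    note bound[THEN conjunct2]
    also have "C * ((\<Prod>n=1..4. V_norm (5 / 6 + \<delta>) (v n)) * V_norm (5 / 6) (v 5) * V_norm (5 / 6) (v 6)) \<le>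
        C * ((\<Prod>n=1..4. V_norm (5 / 6 + \<delta>) (v n)) * V_norm (5 / 6 + \<delta>) (v 5) * V_norm (5 / 6 + \<delta>) (v 6))"
      using C v lower
      by (intro mult_left_mono mult_mono mult_nonneg_nonneg prod_nonneg ballI V_norm_nonneg) auto
    also have "\<dots> = C * (\<Prod>n=1..6. V_norm (5 / 6 + \<delta>) (v n))"
      unfolding I[symmetric] by simp
    finally show "\<bar>spacetime_integral (\<lambda>t x. \<Prod>n=1..6. V_fun (v n) t x)\<bar> \<le> C * (\<Prod>n=1..6. V_norm (5 / 6 + \<delta>) (v n))" .
  qed
next
  fix \<delta> :: real assume \<delta>: "\<delta> > 0"
  \<comment> \<open>The excess of \<theta> = 1/2 + \<eta> over the critical value in 4 (\<theta> -
    1) > -2; it stays below \<delta> for the sup bound, and the cap ensures \<theta> <= 1.\<close>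
  define \<eta> where "\<eta> = min (\<delta> / 2) (1 / 2)"
  have \<eta>: "0 < \<eta>" "\<eta> \<le> 1 / 2" "\<eta> < \<delta>"
    using \<delta> by (auto simp: \<eta>_def min_def)
  have I: "insert 1 (insert 6 {2..5}) = {1..6::nat}" and I': "insert 6 {1..5} = {1..6::nat}"
    by auto
  \<comment> \<open>Integrability can use the order 1 of the sixth factor, so the multilinear
    estimate applies with factors 1 and 6 in L^2 and without transfer of weights.\<close>
  have integrable: "spacetime_integrable (\<lambda>t x. \<Prod>n=1..6. V_fun (v n) t x)"
    if v: "\<forall>n\<in>{1..5}. v n \<in> V_space (1 + \<delta>)" "v 6 \<in> V_space 1" for v :: "nat \<Rightarrow> nat \<Rightarrow> real"
  proof -
    have "v 1 \<in> V_space (1 + \<delta>)"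
      using v by auto
    then have "v 1 \<in> V_space 1"
      using V_norm_mono(1) \<delta> by fastforce
    then show ?thesis
      using spacetime_multilinear_estimate[of "{2..5::nat}" 1 6 "1 / 2 + \<eta>" "1 + \<delta>" 1 1] v \<eta>
        V_space_summable_abs[of "v 1" 1] V_space_summable_abs[of "v 6" 1]
      unfolding I by auto
  qed
  have "\<exists>C>0. \<forall>v N. (\<forall>n\<in>{1..5::nat}. v n \<in> V_space (1 + \<delta>)) \<and> v 6 \<in> V_space (- \<delta>) \<and>
      (\<forall>n\<in>insert 6 {1..5}. \<forall>j\<ge>N. v n j = 0) \<longrightarrow>
      \<bar>spacetime_integral (\<lambda>t x. \<Prod>n\<in>insert 6 {1..5}. V_fun (v n) t x)\<bar>
        \<le> C * ((\<Prod>n=1..5. V_norm (1 + \<delta>) (v n)) * V_norm (- \<delta>) (v 6))"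
    by (rule spacetime_negative_order_estimate_finite[where \<theta> = "1 / 2 + \<eta>"]) (use \<delta> \<eta> in auto)
  then obtain C where C: "C > 0" and est: "\<And>v N. (\<forall>n\<in>{1..5::nat}. v n \<in> V_space (1 + \<delta>)) \<Longrightarrow> v 6 \<in> V_space (- \<delta>) \<Longrightarrow>
      (\<forall>n\<in>{1..6}. \<forall>j\<ge>N. v n j = 0) \<Longrightarrow>
      \<bar>spacetime_integral (\<lambda>t x. \<Prod>n=1..6. V_fun (v n) t x)\<bar>
        \<le> C * ((\<Prod>n=1..5. V_norm (1 + \<delta>) (v n)) * V_norm (- \<delta>) (v 6))"
    unfolding I' by blast
  show "\<exists>C>0. \<forall>v :: nat \<Rightarrow> nat \<Rightarrow> real.
           (\<forall>n\<in>{1..5}. v n \<in> V_space (1 + \<delta>)) \<and> v 6 \<in> V_space 1 \<longrightarrow>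
             spacetime_integrable (\<lambda>t x. \<Prod>n=1..6. V_fun (v n) t x) \<and>
             \<bar>spacetime_integral (\<lambda>t x. \<Prod>n=1..6. V_fun (v n) t x)\<bar>
               \<le> C * (\<Prod>n=1..5. V_norm (1 + \<delta>) (v n)) * V_norm (- \<delta>) (v 6)"
  proof (intro exI[of _ C] conjI C allI impI)
    fix v :: "nat \<Rightarrow> nat \<Rightarrow> real"
    assume "(\<forall>n\<in>{1..5}. v n \<in> V_space (1 + \<delta>)) \<and> v 6 \<in> V_space 1"
    then have v: "\<forall>n\<in>{1..5}. v n \<in> V_space (1 + \<delta>)" "v 6 \<in> V_space 1"
      by auto
    show "spacetime_integrable (\<lambda>t x. \<Prod>n=1..6. V_fun (v n) t x)"
      by (rule integrable[OF v])
    define s where "s n = (if n = 6 then 1 else 1 + \<delta>)" for n :: nat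
    \<comment> \<open>For the limit all six factors are bounded uniformly. Order 1 forces an
      exponent below 1/2 on the sixth, and the other five compensate: the total is -3 + 4 \<eta> >
      -3.\<close>
    define \<theta> where "\<theta> n = (if n = 6 then 1 / 2 - \<eta> else 1 / 2 + \<eta>)" for n :: nat
    have lim: "(\<lambda>N. spacetime_integral (\<lambda>t x. \<Prod>n=1..6. V_fun (truncation N (v n)) t x))
        \<longlonglongrightarrow> spacetime_integral (\<lambda>t x. \<Prod>n=1..6. V_fun (v n) t x)"
    proof (rule tendsto_spacetime_integral_truncation[where s = s and \<theta> = \<theta>])
      show "(\<Sum>n=1..6. \<theta> n - 1) > -3"
        unfolding I'[symmetric] using \<eta> by (simp add: \<theta>_def)
    qed (use v \<eta> in \<open>auto simp: s_def \<theta>_def\<close>)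
    have v6: "v 6 \<in> V_space (- \<delta>)"
      using V_norm_mono(1)[OF v(2)] \<delta> by simp
    \<comment> \<open>The bound is uniform in \<open>N\<close>, as truncation does not increase
      norms, and hence survives the limit.\<close>
    have "\<bar>spacetime_integral (\<lambda>t x. \<Prod>n=1..6. V_fun (truncation N (v n)) t x)\<bar> \<le>
        C * (\<Prod>n=1..5. V_norm (1 + \<delta>) (v n)) * V_norm (- \<delta>) (v 6)" for N
    proof -
      have "\<bar>spacetime_integral (\<lambda>t x. \<Prod>n=1..6. V_fun (truncation N (v n)) t x)\<bar> \<le>
          C * ((\<Prod>n=1..5. V_norm (1 + \<delta>) (truncation N (v n))) * V_norm (- \<delta>) (truncation N (v 6)))"
        using v v6 by (intro est[where N = N]) (auto intro: truncation_V_space simp: truncation_def)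
      also have "\<dots> \<le> C * ((\<Prod>n=1..5. V_norm (1 + \<delta>) (v n)) * V_norm (- \<delta>) (v 6))"
        using C v v6
        by (intro mult_left_mono mult_mono prod_mono conjI prod_nonneg ballI V_norm_nonneg truncation_V_space) auto
      finally show ?thesis
        by (simp add: mult.assoc)
    qed
    then show "\<bar>spacetime_integral (\<lambda>t x. \<Prod>n=1..6. V_fun (v n) t x)\<bar>
        \<le> C * (\<Prod>n=1..5. V_norm (1 + \<delta>) (v n)) * V_norm (- \<delta>) (v 6)"
      by (intro LIMSEQ_le_const2[OF tendsto_rabs[OF lim]]) auto
  qed
qed

end
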